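(* Let $v,w\in S_n$ with $v\le w$ in Bruhat order. The extremal ray generators of the cone $\sigma_{v,w}$ of $T$-weights on the Kazhdan--Lusztig variety $\mathcal{N}_{v,w}$ are the weights $e_{v(j)}-e_i$ corresponding to the coordinates $z_{ij}$, $(i,j)\in D^\circ(v)$, such that $t_{v(j),i}\,v\le w$ and $\ell(t_{v(j),i}\,v)-\ell(v)=1$.
   Context: Let $G=GL_n(\mathbb{C})$, $B$ the upper triangular Borel subgroup, $B_-$ the lower triangular one, $T$ the diagonal torus. A permutation $w\in S_n$ is identified with the permutation matrix having $1$ in position $(w(j),j)$ for each $j$. $\ell(v)$ is the Coxeter length (number of inversions). The Schubert variety $X_w\subset G/B$ is the closure of $BwB/B$; the opposite Schubert cell is $\Omega_v^\circ=B_-vB/B$; the Kazhdan--Lusztig variety is $\mathcal{N}_{v,w}=X_w\cap\Omega_v^\circ$. The usual torus action on it is the restriction of the left $T$-action on $G/B$. Bruhat order: $v\le w$ iff $r_v(a,b)\le r_w(a,b)$ for all $a,b\in[n]$, where $r_M(a,b)$ is the rank of the submatrix of $M$ with rows $a,\dots,n$ and columns $1,\dots,b$. $t_{a,b}$ is the transposition exchanging the values $a$ and $b$, and $t_{a,b}v$ is the composition $t_{a,b}\circ v$. The opposite Rothe diagram is $D^\circ(v)=\{(i,j): v(j)<i,\ v^{-1}(i)>j\}$. Let $\Sigma_v\subset\mathbb{C}^{n\times n}$ be the space of matrices $Z$ with $Z_{v(i),i}=1$ for all $i$, $Z_{v(i),a}=0$ for $a>i$, and $Z_{b,i}=0$ for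 $b<v(i)$; the remaining free entries are $z_{ij}$, $(i,j)\in D^\circ(v)$. The map $Z\mapsto ZB$ is an isomorphism $\Sigma_v\cong\Omega_v^\circ$, under which $\mathcal{N}_{v,w}\cong\overline{X_w}\cap\Sigma_v$, where $\overline{X_w}=\overline{BwB}\subset\mathbb{C}^{n\times n}$ (Zariski closure) is the matrix Schubert variety. The induced action of $M\in T$ on $Z\in\Sigma_v$ is $M\cdot Z=MZ(v^{-1}M^{-1}v)$, and, with the convention used here, the variable $z_{ij}$ has weight $e_{v(j)}-e_i$, where $e_1,\dots,e_n$ is the standard basis of the real character space of $T$, identified with $\mathbb{R}^n$. The weight cone $\sigma_{v,w}\subset\mathbb{R}^n$ is the convex polyhedral cone generated by all weights of the $T$-action on $\mathcal{N}_{v,w}$, i.e. by the weights occurring in the coordinate ring $\mathbb{C}[\mathcal{N}_{v,w}]$ (with the sign convention that the variable $z_{ij}$ has weight $e_{v(j)}-e_i$). *)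

theory Defs
  imports "HOL-Analysis.Analysis"
begin

text \<open>
  The index set \<open>[n]\<close> is an arbitrary finite linearly ordered type \<open>'n\<close>, so that \<open>n = CARD('n)\<close>.
  Permutations are functions \<open>v :: 'n \<Rightarrow> 'n\<close> with \<open>v permutes UNIV\<close>.
\<close>

type_synonym 'n cmat = "complex^'n^'n"
type_synonym 'n rvec = "real^'n"


section \<open>Permutations\<close>

definition perm_mat :: "('n::finite \<Rightarrow> 'n) \<Rightarrow> 'n cmat" where
  "perm_mat w = (\<chi> i j. if i = w j then 1 else 0)"

definition coxeter_length :: "('n::{finite,linorder} \<Rightarrow> 'n) \<Rightarrow> nat" where
  "coxeter_length w = card {(i, j). i < j \<and> w j < w i}"

text \<open>The entries outside the southwest submatrix are replaced by zero, which does not affect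
  its rank.\<close>

definition sw_rank :: "'n::{finite,linorder} cmat \<Rightarrow> 'n \<Rightarrow> 'n \<Rightarrow> nat" where
  "sw_rank M a b = rank (\<chi> i j. if a \<le> i \<and> j \<le> b then M $ i $ j else 0)"

definition bruhat_le :: "('n::{finite,linorder} \<Rightarrow> 'n) \<Rightarrow> ('n \<Rightarrow> 'n) \<Rightarrow> bool" where
  "bruhat_le v w \<longleftrightarrow> (\<forall>a b. sw_rank (perm_mat v) a b \<le> sw_rank (perm_mat w) a b)"

definition opp_rothe_diagram :: "('n::{finite,linorder} \<Rightarrow> 'n) \<Rightarrow> ('n \<times> 'n) set" where
  "opp_rothe_diagram v = {(i, j). v j < i \<and> j < inv v i}"


section \<open>The flag variety\<close>

definition GL :: "'n::finite cmat set" where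
  "GL = {g. invertible g}"

definition borel_upper :: "'n::{finite,linorder} cmat set" where
  "borel_upper = {b \<in> GL. \<forall>i j. j < i \<longrightarrow> b $ i $ j = 0}"

definition borel_lower :: "'n::{finite,linorder} cmat set" where
  "borel_lower = {b \<in> GL. \<forall>i j. i < j \<longrightarrow> b $ i $ j = 0}"

definition torus :: "'n::finite cmat set" where
  "torus = {t \<in> GL. \<forall>i j. i \<noteq> j \<longrightarrow> t $ i $ j = 0}"

text \<open>Points of \<open>G/B\<close> are the cosets \<open>gB\<close>.\<close>

definition flag_coset :: "'n::{finite,linorder} cmat \<Rightarrow> 'n cmat set" where
  "flag_coset g = (\<lambda>b. g ** b) ` borel_upper"

definition flag_variety :: "'n::{finite,linorder} cmat set set" where
  "flag_variety = flag_coset ` GL"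

definition left_act :: "'n::finite cmat \<Rightarrow> 'n cmat set \<Rightarrow> 'n cmat set" where
  "left_act g x = (\<lambda>h. g ** h) ` x"


section \<open>Zariski topology\<close>

text \<open>Polynomial functions of the matrix entries. Over the infinite field \<open>\<complex>\<close> these are the same
  thing as polynomials in the \<open>n\<^sup>2\<close> entries.\<close>

inductive poly_fun :: "('n::finite cmat \<Rightarrow> complex) \<Rightarrow> bool" where
  const: "poly_fun (\<lambda>_. c)"
| entry: "poly_fun (\<lambda>Z. Z $ i $ j)"
| add: "poly_fun p \<Longrightarrow> poly_fun q \<Longrightarrow> poly_fun (\<lambda>Z. p Z + q Z)"
| mult: "poly_fun p \<Longrightarrow> poly_fun q \<Longrightarrow> poly_fun (\<lambda>Z. p Z * q Z)"

definition zariski_closed :: "'n::finite cmat set \<Rightarrow> bool" where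
  "zariski_closed V \<longleftrightarrow> (\<exists>P. (\<forall>p\<in>P. poly_fun p) \<and> V = {Z. \<forall>p\<in>P. p Z = 0})"

text \<open>The Zariski topology of \<open>G/B\<close> is the quotient topology along the open surjection
  \<open>G \<rightarrow> G/B\<close>, where \<open>G\<close> carries the subspace topology from the space of all matrices.\<close>

definition flag_closed :: "'n::{finite,linorder} cmat set set \<Rightarrow> bool" where
  "flag_closed C \<longleftrightarrow> C \<subseteq> flag_variety \<and>
     (\<exists>V. zariski_closed V \<and> {g \<in> GL. flag_coset g \<in> C} = V \<inter> GL)"


section \<open>Kazhdan--Lusztig varieties\<close>

definition schubert_cell :: "('n::{finite,linorder} \<Rightarrow> 'n) \<Rightarrow> 'n cmat set set" where
  "schubert_cell w = {flag_coset (b ** perm_mat w ** b') |b b'. b \<in> borel_upper \<and> b' \<in> borel_upper}"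

definition schubert_variety :: "('n::{finite,linorder} \<Rightarrow> 'n) \<Rightarrow> 'n cmat set set" where
  "schubert_variety w = flag_closed hull schubert_cell w"

definition opp_schubert_cell :: "('n::{finite,linorder} \<Rightarrow> 'n) \<Rightarrow> 'n cmat set set" where
  "opp_schubert_cell v =
     {flag_coset (b ** perm_mat v ** b') |b b'. b \<in> borel_lower \<and> b' \<in> borel_upper}"

definition kazhdan_lusztig ::
    "('n::{finite,linorder} \<Rightarrow> 'n) \<Rightarrow> ('n \<Rightarrow> 'n) \<Rightarrow> 'n cmat set set" where
  "kazhdan_lusztig v w = schubert_variety w \<inter> opp_schubert_cell v"

text \<open>The affine space \<open>\<Sigma>\<^sub>v\<close>. The map \<open>Z \<mapsto> ZB\<close> is an isomorphism from it onto the opposite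
  Schubert cell, and the entries at the positions in \<open>opp_rothe_diagram v\<close> are its free coordinates.\<close>

definition cell_chart :: "('n::{finite,linorder} \<Rightarrow> 'n) \<Rightarrow> 'n cmat set" where
  "cell_chart v = {Z. (\<forall>i. Z $ v i $ i = 1) \<and> (\<forall>i a. i < a \<longrightarrow> Z $ v i $ a = 0) \<and>
                      (\<forall>i b. b < v i \<longrightarrow> Z $ b $ i = 0)}"

text \<open>Since \<open>N\<^sub>v\<^sub>,\<^sub>w\<close> is closed in the opposite cell, its coordinate ring consists of the functions
  that become polynomial in the matrix entries on \<open>\<Sigma>\<^sub>v\<close>. Only the values of \<open>f\<close> on the set \<open>N\<^sub>v\<^sub>,\<^sub>w\<close> matter.\<close>

definition kl_regular ::
    "('n::{finite,linorder} \<Rightarrow> 'n) \<Rightarrow> ('n \<Rightarrow> 'n) \<Rightarrow> ('n cmat set \<Rightarrow> complex) \<Rightarrow> bool" where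
  "kl_regular v w f \<longleftrightarrow>
     (\<exists>p. poly_fun p \<and>
        (\<forall>Z\<in>cell_chart v. flag_coset Z \<in> kazhdan_lusztig v w \<longrightarrow> f (flag_coset Z) = p Z))"


section \<open>Weights and the weight cone\<close>

definition character :: "('n::finite \<Rightarrow> int) \<Rightarrow> 'n cmat \<Rightarrow> complex" where
  "character m t = (\<Prod>i\<in>UNIV. (t $ i $ i) powi m i)"

definition char_vec :: "('n::finite \<Rightarrow> int) \<Rightarrow> 'n rvec" where
  "char_vec m = (\<chi> i. of_int (m i))"

text \<open>The torus acts on functions by \<open>(t \<cdot> f)(x) = f (t\<^sup>-\<^sup>1 x)\<close>. The entry in position \<open>(i, j)\<close> of
  \<open>t\<^sup>-\<^sup>1 Z (v\<^sup>-\<^sup>1 t v)\<close> is \<open>t\<^sub>v\<^sub>(\<^sub>j\<^sub>) t\<^sub>i\<^sup>-\<^sup>1 z\<^sub>i\<^sub>j\<close>, so the coordinate \<open>z\<^sub>i\<^sub>j\<close> has weight \<open>e\<^sub>v\<^sub>(\<^sub>j\<^sub>) - e\<^sub>i\<close>.\<close>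

definition kl_weights :: "('n::{finite,linorder} \<Rightarrow> 'n) \<Rightarrow> ('n \<Rightarrow> 'n) \<Rightarrow> 'n rvec set" where
  "kl_weights v w = {char_vec m |m. \<exists>f. kl_regular v w f \<and>
     (\<exists>x\<in>kazhdan_lusztig v w. f x \<noteq> 0) \<and>
     (\<forall>t\<in>torus. \<forall>x\<in>kazhdan_lusztig v w. f (left_act (matrix_inv t) x) = character m t * f x)}"

definition weight_cone :: "('n::{finite,linorder} \<Rightarrow> 'n) \<Rightarrow> ('n \<Rightarrow> 'n) \<Rightarrow> 'n rvec set" where
  "weight_cone v w = convex_cone hull kl_weights v w"

definition extremal_rays :: "'n::finite rvec set \<Rightarrow> 'n rvec set set" where
  "extremal_rays C = {conic hull {u} |u. u \<noteq> 0 \<and> (conic hull {u}) face_of C}"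

text \<open>As usual, the generator of a rational ray is its primitive lattice vector.\<close>

definition extremal_ray_generators :: "'n::finite rvec set \<Rightarrow> 'n rvec set" where
  "extremal_ray_generators C =
     {char_vec m |m. Gcd (range m) = 1 \<and> conic hull {char_vec m} \<in> extremal_rays C}"

definition coordinate_weight :: "('n::finite \<Rightarrow> 'n) \<Rightarrow> 'n \<Rightarrow> 'n \<Rightarrow> 'n rvec" where
  "coordinate_weight v i j = axis (v j) 1 - axis i 1"

end

theory Submission
  imports Defs
begin

text \<open>
  Points of the Kazhdan--Lusztig variety are handled through their unique representatives in the
  affine space \<open>\<Sigma>\<^sub>v\<close> (\<open>cell_chart_surj\<close>, \<open>cell_chart_unique\<close>). In these coordinates the torus rescales
  the entry \<open>z\<^sub>i\<^sub>j\<close> by its weight \<open>e\<^sub>v\<^sub>(\<^sub>j\<^sub>) - e\<^sub>i\<close>. Call such a weight a root of the variety if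
  \<open>z\<^sub>i\<^sub>j\<close> does not vanish identically on it.

  The roots generate the weight cone (\<open>weight_cone_eq\<close>). Each root is the weight of a nonzero coordinate
  function. Conversely, if a weight \<open>m\<close> lay outside the cone of the roots, some real
  functional \<open>l\<close> would be nonnegative on all roots and negative on \<open>m\<close>. Along the one-parameter
  subgroup defined by \<open>l\<close> every point of the variety has a limit, so a regular function stays
  bounded on the orbit, whereas a weight vector of weight \<open>m\<close> blows up.

  The same degeneration finds the extremal roots. Choose an irredundant generating set among
  the roots, and let \<open>r\<close> be one of its members, the weight of \<open>z\<^sub>i\<^sub>j\<close>. Some functional \<open>l\<close> vanishes on \<open>r\<close>
  and is positive on all other roots, and flowing along it moves a point with \<open>z\<^sub>i\<^sub>j \<noteq> 0\<close> to a point at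
  which \<open>z\<^sub>i\<^sub>j\<close> is the only nonzero coordinate. That point lies on the
  torus-stable curve joining the fixed points \<open>v\<close> and \<open>t v\<close>, where \<open>t\<close> is the transposition of \<open>v(j)\<close>
  and \<open>i\<close>. Away from \<open>v\<close> this curve is in the Borel orbit of \<open>t v\<close>, so \<open>t v\<close> is in \<open>X\<^sub>w\<close>, that
  is, \<open>t v \<le> w\<close>. If the length went up by more than one, there would be a value strictly between
  \<open>v(j)\<close> and \<open>i\<close> at a position strictly between theirs. It would split \<open>r\<close> into a sum of two roots, which
  contradicts the choice of \<open>l\<close> (\<open>exposed_kl_root_is_cover_root\<close>).
  Conversely, for \<open>t v \<le> w\<close> the curve lies in \<open>X\<^sub>w\<close> and makes \<open>z\<^sub>i\<^sub>j\<close> nonzero; and if \<open>t v\<close> covers \<open>v\<close>,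
  an explicit functional shows that the weight is not in the cone of the other cover
  weights (\<open>cover_root_irredundant\<close>). An irredundant finite generating set of a pointed cone spans
  exactly its extremal rays (\<open>extremal_rays_irredundant\<close>).

  The argument uses that the rank conditions defining the Bruhat order describe which torus-fixed points lie
  in \<open>X\<^sub>w\<close>. Necessity holds because Borel translations do not increase southwest ranks and a
  large rank is detected by a determinant
  (\<open>perm_mat_in_schubert_variety_imp_bruhat_le\<close>). For sufficiency, any \<open>u < w\<close> can be
  raised by a transposition while staying below \<open>w\<close> (\<open>bruhat_le_chain_step\<close>), and \<open>u\<close> is a limit of
  points in the Borel orbit of the raised permutation
  (\<open>bruhat_le_imp_perm_mat_in_schubert_variety\<close>).
\<close>

section \<open>Polynomial functions\<close>

lemma poly_fun_sum:
  assumes "finite S" and "\<And>x. x \<in> S \<Longrightarrow> poly_fun (F x)"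
  shows "poly_fun (\<lambda>Z. \<Sum>x\<in>S. F x Z)"
  using assms
proof (induction S rule: finite_induct)
  case empty
  show ?case using poly_fun.const[of 0] by simp
next
  case (insert x S)
  then show ?case using poly_fun.add[of "F x" "\<lambda>Z. \<Sum>x\<in>S. F x Z"] by simp
qed

lemma poly_fun_prod:
  assumes "finite S" and "\<And>x. x \<in> S \<Longrightarrow> poly_fun (F x)"
  shows "poly_fun (\<lambda>Z. \<Prod>x\<in>S. F x Z)"
  using assms
proof (induction S rule: finite_induct)
  case empty
  show ?case using poly_fun.const[of 1] by simp
next
  case (insert x S)
  then show ?case using poly_fun.mult[of "F x" "\<lambda>Z. \<Prod>x\<in>S. F x Z"] by simp
qed

lemma poly_fun_det:
  assumes "\<And>i j. poly_fun (\<lambda>Z. M Z $ i $ j)"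
  shows "poly_fun (\<lambda>Z. det (M Z))"
  unfolding det_def
  by (intro poly_fun_sum poly_fun.mult poly_fun_prod poly_fun.const assms finite_permutations) auto

lemma poly_fun_compose:
  assumes "poly_fun p" and "\<And>i j. poly_fun (\<lambda>Z. M Z $ i $ j)"
  shows "poly_fun (\<lambda>Z. p (M Z))"
  using assms(1) by induction (auto intro: poly_fun.intros assms(2))

lemma poly_fun_mult_left: "poly_fun p \<Longrightarrow> poly_fun (\<lambda>Z. p (g ** Z))"
  by (erule poly_fun_compose)
     (auto simp: matrix_matrix_mult_def intro!: poly_fun_sum poly_fun.mult poly_fun.const poly_fun.entry)

lemma poly_fun_mult_right: "poly_fun p \<Longrightarrow> poly_fun (\<lambda>Z. p (Z ** g))"
  by (erule poly_fun_compose)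
     (auto simp: matrix_matrix_mult_def intro!: poly_fun_sum poly_fun.mult poly_fun.const poly_fun.entry)

lemma tendsto_poly_fun:
  assumes "poly_fun p" and "\<And>i j. ((\<lambda>x. G x $ i $ j) \<longlongrightarrow> Z $ i $ j) F"
  shows "((\<lambda>x. p (G x)) \<longlongrightarrow> p Z) F"
  using assms(1) by induction (auto intro!: tendsto_add tendsto_mult assms(2))

section \<open>Triangular matrices and the Borel subgroup\<close>

text \<open>
  The labelling \<open>\<phi>\<close> fixes the order in which the matrix is triangular: upper and lower triangular
  matrices are both instances, and so are the matrices, triangular in the order of the values of \<open>v\<close>,
  that arise in normalising a point of the opposite cell. By induction on the label, a permutation
  that never raises labels is the identity, so only the diagonal term of the determinant survives.
\<close>

lemma det_triangular:
  fixes \<phi> :: "'n::finite \<Rightarrow> nat" and A :: "'a::comm_ring_1^'n^'n"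
  assumes "inj \<phi>" and tri: "\<And>i j. \<phi> i < \<phi> j \<Longrightarrow> A $ i $ j = 0"
  shows "det A = (\<Prod>i\<in>UNIV. A $ i $ i)"
proof -
  let ?term = "\<lambda>p. of_int (sign p) * (\<Prod>i\<in>UNIV. A $ i $ p i)"
  have zero: "?term p = 0" if p: "p permutes UNIV" and "p \<noteq> id" for p :: "'n \<Rightarrow> 'n"
  proof (rule ccontr)
    assume "?term p \<noteq> 0"
    then have ne: "A $ i $ p i \<noteq> 0" for i
      by (metis (no_types, lifting) UNIV_I finite mult_zero_right prod_zero)
    have le: "\<phi> (p i) \<le> \<phi> i" for i
      using tri ne by (meson not_le)
    have "p i = i" for i
    proof (induction "\<phi> i" arbitrary: i rule: less_induct)
      case less
      show ?case
      proof (cases "\<phi> (p i) < \<phi> i")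
        case True
        then have "p (p i) = p i" using less by blast
        then show ?thesis using p by (metis permutes_def)
      next
        case False
        then show ?thesis using le[of i] \<open>inj \<phi>\<close> by (simp add: inj_eq)
      qed
    qed
    then show False using \<open>p \<noteq> id\<close> by auto
  qed
  have "det A = (\<Sum>p\<in>{id}. ?term p)"
    unfolding det_def
    by (rule sum.mono_neutral_right) (auto simp: finite_permutations permutes_id zero)
  then show ?thesis by (simp add: sign_id)
qed

lemma strict_mono_position:
  "i < j \<Longrightarrow> card {x::'n::{finite,linorder}. x < i} < card {x. x < j}"
  by (rule psubset_card_mono) (auto)

lemma inj_position: "inj (\<lambda>i::'n::{finite,linorder}. card {x. x < i})"
  by (rule injI) (metis strict_mono_position less_irrefl linorder_neqE)

lemma strict_antimono_coposition:
  "i < j \<Longrightarrow> card {x::'n::{finite,linorder}. j < x} < card {x. i < x}"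
  by (rule psubset_card_mono) (auto)

lemma inj_coposition: "inj (\<lambda>i::'n::{finite,linorder}. card {x. i < x})"
  by (rule injI) (metis strict_antimono_coposition less_irrefl linorder_neqE)

lemma det_upper:
  fixes A :: "'n::{finite,linorder} cmat"
  assumes "\<And>i j. j < i \<Longrightarrow> A $ i $ j = 0"
  shows "det A = (\<Prod>i\<in>UNIV. A $ i $ i)"
  by (rule det_triangular[OF inj_coposition])
     (metis assms strict_antimono_coposition less_asym linorder_neqE less_irrefl)

lemma det_lower:
  fixes A :: "'n::{finite,linorder} cmat"
  assumes "\<And>i j. i < j \<Longrightarrow> A $ i $ j = 0"
  shows "det A = (\<Prod>i\<in>UNIV. A $ i $ i)"
  by (rule det_triangular[OF inj_position])
     (metis assms strict_mono_position less_asym linorder_neqE less_irrefl)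

lemma borel_upper_iff:
  "b \<in> borel_upper \<longleftrightarrow> (\<forall>i j. j < i \<longrightarrow> b $ i $ j = 0) \<and> (\<forall>i. b $ i $ i \<noteq> 0)"
  unfolding borel_upper_def GL_def
  by (auto simp: invertible_det_nz det_upper)

lemma borel_lower_iff:
  "b \<in> borel_lower \<longleftrightarrow> (\<forall>i j. i < j \<longrightarrow> b $ i $ j = 0) \<and> (\<forall>i. b $ i $ i \<noteq> 0)"
  unfolding borel_lower_def GL_def
  by (auto simp: invertible_det_nz det_lower)

lemma one_in_borel_upper: "mat 1 \<in> borel_upper"
  by (auto simp: borel_upper_iff mat_def)

lemma GL_mult: "g \<in> GL \<Longrightarrow> h \<in> GL \<Longrightarrow> g ** h \<in> GL"
  by (simp add: GL_def invertible_mult)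

lemma borel_upper_GL: "b \<in> borel_upper \<Longrightarrow> b \<in> GL"
  by (simp add: borel_upper_def)

lemma borel_upper_mult:
  assumes "b \<in> borel_upper" "c \<in> borel_upper"
  shows "b ** c \<in> borel_upper"
proof -
  have "(b ** c) $ i $ j = 0" if "j < i" for i j
  proof -
    have zero: "b $ i $ k * c $ k $ j = 0" for k
    proof (cases "k < i")
      case True
      then show ?thesis using assms(1) by (simp add: borel_upper_iff)
    next
      case False
      then have "j < k" using that by simp
      then show ?thesis using assms(2) by (simp add: borel_upper_iff)
    qed
    show ?thesis by (simp add: matrix_matrix_mult_def zero)
  qed
  then show ?thesis
    using assms GL_mult by (auto simp: borel_upper_def)
qed

text \<open>
  If the inverse had an entry below the diagonal, the lowest such entry in its column would produce, multiplied by a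
  nonzero diagonal entry, a nonzero off-diagonal entry of the identity.
\<close>

lemma borel_upper_inverse:
  assumes "b \<in> borel_upper"
  obtains c where "c \<in> borel_upper" "b ** c = mat 1" "c ** b = mat 1"
proof -
  obtain c where c: "b ** c = mat 1" "c ** b = mat 1"
    using assms by (auto simp: borel_upper_def GL_def invertible_def)
  have "c $ i $ j = 0" if "j < i" for i j
  proof (rule ccontr)
    assume "c $ i $ j \<noteq> 0"
    define S where "S = {k. j < k \<and> c $ k $ j \<noteq> 0}"
    have "finite S" "i \<in> S" using that \<open>c $ i $ j \<noteq> 0\<close> by (auto simp: S_def)
    then have k: "Max S \<in> S" and max: "\<And>l. l \<in> S \<Longrightarrow> l \<le> Max S"
      using Max_in[of S] Max_ge[of S] by blast+
    let ?k = "Max S"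
    have "(b ** c) $ ?k $ j = (\<Sum>l\<in>UNIV. b $ ?k $ l * c $ l $ j)"
      by (simp add: matrix_matrix_mult_def)
    also have "\<dots> = (\<Sum>l\<in>{?k}. b $ ?k $ l * c $ l $ j)"
    proof (rule sum.mono_neutral_right)
      show "\<forall>l\<in>UNIV - {?k}. b $ ?k $ l * c $ l $ j = 0"
      proof
        fix l assume "l \<in> UNIV - {?k}"
        then consider "l < ?k" | "?k < l" by (metis Diff_iff linorder_neqE singletonI)
        then show "b $ ?k $ l * c $ l $ j = 0"
        proof cases
          case 1
          then show ?thesis using assms by (simp add: borel_upper_iff)
        next
          case 2
          then have "l \<notin> S" using max by (meson not_le)
          then show ?thesis using 2 k by (auto simp: S_def)
        qed
      qed
    qed auto
    also have "\<dots> \<noteq> 0" using k assms by (auto simp: S_def borel_upper_iff)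
    finally have "j = ?k" using c(1) by (simp add: mat_def split: if_splits)
    then show False using k by (simp add: S_def)
  qed
  then have "c \<in> borel_upper" using c by (auto simp: borel_upper_def GL_def invertible_def)
  then show ?thesis using that c by blast
qed

lemma flag_coset_mult_right:
  assumes "b \<in> borel_upper"
  shows "flag_coset (g ** b) = flag_coset g"
proof
  show "flag_coset (g ** b) \<subseteq> flag_coset g"
    using assms borel_upper_mult by (auto simp: flag_coset_def simp flip: matrix_mul_assoc)
  obtain c where c: "c \<in> borel_upper" "b ** c = mat 1" using borel_upper_inverse[OF assms] by metis
  show "flag_coset g \<subseteq> flag_coset (g ** b)"
  proof
    fix h assume "h \<in> flag_coset g"
    then obtain d where d: "d \<in> borel_upper" "h = g ** d" by (auto simp: flag_coset_def)
    have "h = g ** b ** (c ** d)"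
      using c d by (metis matrix_mul_assoc matrix_mul_lid)
    then show "h \<in> flag_coset (g ** b)"
      using c d borel_upper_mult by (auto simp: flag_coset_def)
  qed
qed

lemma self_in_flag_coset: "g \<in> flag_coset g"
  unfolding flag_coset_def using one_in_borel_upper by (metis imageI matrix_mul_rid)

lemma flag_coset_eqD:
  assumes "flag_coset g = flag_coset h"
  obtains b where "b \<in> borel_upper" "h = g ** b"
  using self_in_flag_coset[of h] assms unfolding flag_coset_def by auto

lemma left_act_flag_coset: "left_act t (flag_coset g) = flag_coset (t ** g)"
  by (auto simp: left_act_def flag_coset_def image_image matrix_mul_assoc)

lemma matrix_mult_perm_mat_entry: "(M ** perm_mat v) $ i $ j = M $ i $ v j"
  by (simp add: perm_mat_def matrix_matrix_mult_def if_distrib cong: if_cong)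

lemma perm_mat_mult_matrix_entry:
  assumes "v permutes UNIV"
  shows "(perm_mat v ** M) $ i $ j = M $ inv v i $ j"
proof -
  have eq: "i = v k \<longleftrightarrow> k = inv v i" for k
    using permutes_inverses[OF assms] by metis
  have "(perm_mat v ** M) $ i $ j = (\<Sum>k\<in>UNIV. if k = inv v i then M $ k $ j else 0)"
    unfolding matrix_matrix_mult_def perm_mat_def vec_lambda_beta eq
    by (rule sum.cong) auto
  then show ?thesis by simp
qed

lemma perm_mat_GL:
  assumes "v permutes UNIV" shows "perm_mat v \<in> GL"
proof -
  have "perm_mat v ** perm_mat (inv v) = mat 1"
    unfolding vec_eq_iff matrix_mult_perm_mat_entry
    by (simp add: perm_mat_def mat_def permutes_inverses[OF assms])
  then show ?thesis unfolding GL_def using invertible_right_inverse by blast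
qed

section \<open>Schubert varieties as closures\<close>

lemma schubert_variety_iff:
  "x \<in> schubert_variety w \<longleftrightarrow> (\<forall>C. flag_closed C \<longrightarrow> schubert_cell w \<subseteq> C \<longrightarrow> x \<in> C)"
  by (auto simp: schubert_variety_def hull_def)

lemma schubert_cell_subset_variety: "schubert_cell w \<subseteq> schubert_variety w"
  unfolding schubert_variety_def by (rule hull_subset)

lemma flag_coset_schubert_cell:
  assumes "b \<in> borel_upper" "b' \<in> borel_upper"
  shows "flag_coset (b ** perm_mat w ** b') \<in> schubert_cell w"
  using assms unfolding schubert_cell_def by blast

lemma schubert_cell_subset_flags:
  assumes "w permutes UNIV"
  shows "schubert_cell w \<subseteq> flag_variety"
  using perm_mat_GL[OF assms] GL_mult borel_upper_GL
  unfolding schubert_cell_def flag_variety_def by blast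

text \<open>
  Translation by \<open>b\<close> pulls closed sets containing the Schubert cell back to closed sets containing
  it, so it preserves the intersection of all of them.
\<close>

lemma schubert_variety_left_act:
  fixes w :: "'n::{finite,linorder} \<Rightarrow> 'n"
  assumes w: "w permutes UNIV" and b: "b \<in> borel_upper" and x: "x \<in> schubert_variety w"
  shows "left_act b x \<in> schubert_variety w"
  unfolding schubert_variety_iff
proof (intro allI impI)
  fix C assume C: "flag_closed C" and cell: "schubert_cell w \<subseteq> C"
  define C' where "C' = {y \<in> flag_variety. left_act b y \<in> C}"
  have bGL: "b \<in> GL" using b by (rule borel_upper_GL)
  have "flag_closed C'"
  proof -
    obtain V where "zariski_closed V" and V: "{g \<in> GL. flag_coset g \<in> C} = V \<inter> GL"
      using C unfolding flag_closed_def by auto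
    then obtain P where P: "\<forall>p\<in>P. poly_fun p" "V = {Z. \<forall>p\<in>P. p Z = 0}"
      unfolding zariski_closed_def by auto
    have "zariski_closed {Z. b ** Z \<in> V}"
      unfolding zariski_closed_def P(2)
      using P(1) poly_fun_mult_left[of _ b]
      by (intro exI[of _ "(\<lambda>p Z. p (b ** Z)) ` P"]) auto
    moreover have "{g \<in> GL. flag_coset g \<in> C'} = {Z. b ** Z \<in> V} \<inter> GL"
    proof -
      have "flag_coset g \<in> C' \<longleftrightarrow> b ** g \<in> V" if "g \<in> GL" for g
      proof -
        have "flag_coset g \<in> C' \<longleftrightarrow> flag_coset (b ** g) \<in> C"
          using that by (simp add: C'_def left_act_flag_coset flag_variety_def)
        also have "\<dots> \<longleftrightarrow> b ** g \<in> V"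
          using V GL_mult[OF bGL that] by blast
        finally show ?thesis .
      qed
      then show ?thesis by auto
    qed
    moreover have "C' \<subseteq> flag_variety" by (auto simp: C'_def)
    ultimately show ?thesis unfolding flag_closed_def by blast
  qed
  moreover have "schubert_cell w \<subseteq> C'"
  proof
    fix y assume y: "y \<in> schubert_cell w"
    then obtain c c' where c: "c \<in> borel_upper" "c' \<in> borel_upper" and
      y_eq: "y = flag_coset (c ** perm_mat w ** c')"
      unfolding schubert_cell_def by blast
    have "left_act b y = flag_coset ((b ** c) ** perm_mat w ** c')"
      by (simp add: y_eq left_act_flag_coset matrix_mul_assoc)
    then have "left_act b y \<in> C"
      using flag_coset_schubert_cell[OF borel_upper_mult[OF b c(1)] c(2)] cell by auto
    then show "y \<in> C'"
      using y schubert_cell_subset_flags[OF w] by (auto simp: C'_def)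
  qed
  ultimately have "x \<in> C'" using x unfolding schubert_variety_iff by blast
  then show "left_act b x \<in> C" by (simp add: C'_def)
qed

text \<open>
  Zariski closed sets are closed under limits in the usual topology, because polynomials are continuous.
\<close>

lemma schubert_variety_limit:
  fixes w :: "'n::{finite,linorder} \<Rightarrow> 'n"
  assumes "F \<noteq> bot" and "g \<in> GL"
    and G: "\<forall>\<^sub>F x in F. G x \<in> GL \<and> flag_coset (G x) \<in> schubert_variety w"
    and lim: "\<And>i j. ((\<lambda>x. G x $ i $ j) \<longlongrightarrow> g $ i $ j) F"
  shows "flag_coset g \<in> schubert_variety w"
  unfolding schubert_variety_iff
proof (intro allI impI)
  fix C assume C: "flag_closed C" and cell: "schubert_cell w \<subseteq> C"
  obtain V where "zariski_closed V" and V: "{g \<in> GL. flag_coset g \<in> C} = V \<inter> GL"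
    using C unfolding flag_closed_def by auto
  then obtain P where P: "\<forall>p\<in>P. poly_fun p" "V = {Z. \<forall>p\<in>P. p Z = 0}"
    unfolding zariski_closed_def by auto
  have ev: "\<forall>\<^sub>F x in F. G x \<in> V"
    using G
  proof eventually_elim
    case (elim x)
    then have "flag_coset (G x) \<in> C" using C cell unfolding schubert_variety_iff by blast
    then show ?case using elim V by blast
  qed
  have "p g = 0" if "p \<in> P" for p
  proof -
    have "((\<lambda>x. p (G x)) \<longlongrightarrow> p g) F"
      by (rule tendsto_poly_fun) (use P(1) that lim in blast)+
    moreover have "((\<lambda>x. p (G x)) \<longlongrightarrow> 0) F"
      by (rule tendsto_eventually) (rule eventually_mono[OF ev], use P(2) that in blast)
    ultimately show ?thesis using tendsto_unique \<open>F \<noteq> bot\<close> by blast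
  qed
  then have "g \<in> V" using P by auto
  then show "flag_coset g \<in> C" using V \<open>g \<in> GL\<close> by blast
qed

text \<open>
  Vanishing of a single polynomial need not be invariant under right multiplication by \<open>B\<close>. The
  closed set of cosets used is the one on which \<open>p\<close> vanishes on the entire coset; it is cut
  out by all right translates of \<open>p\<close>.
\<close>

lemma poly_fun_vanishes_on_schubert_variety:
  fixes w :: "'n::{finite,linorder} \<Rightarrow> 'n"
  assumes w: "w permutes UNIV" and p: "poly_fun p"
    and cell: "\<And>b b'. b \<in> borel_upper \<Longrightarrow> b' \<in> borel_upper \<Longrightarrow> p (b ** perm_mat w ** b') = 0"
    and x: "flag_coset g \<in> schubert_variety w"
  shows "p g = 0"
proof -
  define C where "C = {y \<in> flag_variety. \<forall>h\<in>y. p h = 0}"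
  have "flag_closed C"
    unfolding flag_closed_def
  proof (intro conjI exI)
    show "C \<subseteq> flag_variety" by (auto simp: C_def)
    show "zariski_closed {Z. \<forall>q \<in> (\<lambda>b Z. p (Z ** b)) ` borel_upper. q Z = 0}"
      unfolding zariski_closed_def
      by (rule exI[of _ "(\<lambda>b Z. p (Z ** b)) ` borel_upper"]) (simp add: poly_fun_mult_right[OF p])
    show "{g \<in> GL. flag_coset g \<in> C} = {Z. \<forall>q \<in> (\<lambda>b Z. p (Z ** b)) ` borel_upper. q Z = 0} \<inter> GL"
      by (auto simp: C_def flag_coset_def flag_variety_def)
  qed
  moreover have "schubert_cell w \<subseteq> C"
  proof
    fix y assume y: "y \<in> schubert_cell w"
    then obtain c c' where c: "c \<in> borel_upper" "c' \<in> borel_upper" and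
      y_eq: "y = flag_coset (c ** perm_mat w ** c')"
      unfolding schubert_cell_def by blast
    have "p h = 0" if h: "h \<in> y" for h
    proof -
      obtain d where d: "d \<in> borel_upper" "h = c ** perm_mat w ** c' ** d"
        using h unfolding y_eq flag_coset_def by blast
      then have "h = c ** perm_mat w ** (c' ** d)" by (simp add: matrix_mul_assoc)
      then show ?thesis using cell[OF c(1) borel_upper_mult[OF c(2) d(1)]] by simp
    qed
    then show "y \<in> C" using y schubert_cell_subset_flags[OF w] by (auto simp: C_def)
  qed
  ultimately have "flag_coset g \<in> C" using x unfolding schubert_variety_iff by blast
  then show ?thesis using self_in_flag_coset by (auto simp: C_def)
qed

section \<open>Southwest ranks on Schubert varieties\<close>

text \<open>
  Over a general field the rank is by definition the row rank, and both bounds are proved for the row space.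
\<close>

lemma rank_mult_le_right:
  fixes A :: "'a::field^'m^'k" and B :: "'a^'n^'m"
  shows "rank (A ** B) \<le> rank B"
proof -
  have "row i (A ** B) \<in> vec.span (rows B)" for i
  proof -
    have "row i (A ** B) = (\<Sum>k\<in>UNIV. A $ i $ k *s row k B)"
      by (simp add: vec_eq_iff row_def matrix_matrix_mult_def)
    also have "\<dots> \<in> vec.span (rows B)"
      by (intro vec.span_sum vec.span_scale vec.span_base) (auto simp: rows_def)
    finally show ?thesis .
  qed
  then show ?thesis
    unfolding row_rank_def_gen by (intro vec.dim_mono) (auto simp: rows_def)
qed

lemma rank_mult_le_left:
  fixes A :: "'a::field^'m^'k" and B :: "'a^'n^'m"
  shows "rank (A ** B) \<le> rank A"
proof -
  have lin: "Vector_Spaces.linear (*s) (*s) (\<lambda>x. x v* B)"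
    by unfold_locales
       (simp_all add: vector_matrix_left_distrib scaleR_vector_matrix_assoc
          vec_eq_iff vector_matrix_mult_def sum_distrib_left sum.distrib algebra_simps)
  have "rows (A ** B) = (\<lambda>x. x v* B) ` rows A"
    by (auto simp: rows_def vec_eq_iff row_def matrix_matrix_mult_def vector_matrix_mult_def image_iff)
  then show ?thesis
    unfolding row_rank_def_gen using vec.dim_image_le[OF lin] by simp
qed

definition coord_proj :: "('n::finite \<Rightarrow> bool) \<Rightarrow> 'n cmat" where
  "coord_proj Q = (\<chi> i j. if i = j \<and> Q i then 1 else 0)"

lemma coord_proj_mult_entry: "(coord_proj Q ** M) $ i $ j = (if Q i then M $ i $ j else 0)"
  by (simp add: coord_proj_def matrix_matrix_mult_def if_distrib if_distribR cong: if_cong)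

lemma mult_coord_proj_entry: "(M ** coord_proj Q) $ i $ j = (if Q j then M $ i $ j else 0)"
proof -
  have "(M ** coord_proj Q) $ i $ j = (\<Sum>k\<in>UNIV. if k = j then (if Q j then M $ i $ j else 0) else 0)"
    unfolding coord_proj_def matrix_matrix_mult_def vec_lambda_beta by (rule sum.cong) auto
  then show ?thesis by simp
qed

lemma sw_rank_coord_proj:
  "sw_rank M a b = rank (coord_proj (\<lambda>i. a \<le> i) ** M ** coord_proj (\<lambda>j. j \<le> b))"
  unfolding sw_rank_def
  by (rule arg_cong[of _ _ rank]) (auto simp: vec_eq_iff coord_proj_mult_entry mult_coord_proj_entry)

text \<open>
  Left multiplication by an upper triangular matrix adds only lower rows to a row, and right
  multiplication adds only columns on the left to a column. Hence both commute with the truncation to the southwest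
  corner up to a further truncation.
\<close>

lemma sw_rank_borel_le:
  assumes "c \<in> borel_upper" "c' \<in> borel_upper"
  shows "sw_rank (c ** M ** c') a b \<le> sw_rank M a b"
proof -
  let ?P = "coord_proj (\<lambda>i. a \<le> i)" and ?Q = "coord_proj (\<lambda>j. j \<le> b)"
  have P: "?P ** c = ?P ** c ** ?P"
    using assms(1) by (auto simp: vec_eq_iff coord_proj_mult_entry mult_coord_proj_entry borel_upper_iff)
  have Q: "c' ** ?Q = ?Q ** c' ** ?Q"
    using assms(2) by (auto simp: vec_eq_iff coord_proj_mult_entry mult_coord_proj_entry borel_upper_iff)
  have "?P ** (c ** M ** c') ** ?Q = (?P ** c) ** M ** (c' ** ?Q)"
    by (simp add: matrix_mul_assoc)
  also have "\<dots> = (?P ** c ** ?P) ** M ** (?Q ** c' ** ?Q)"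
    using P Q by simp
  also have "\<dots> = (?P ** c) ** ((?P ** M ** ?Q) ** (c' ** ?Q))"
    by (simp add: matrix_mul_assoc)
  finally have "sw_rank (c ** M ** c') a b = rank ((?P ** c) ** ((?P ** M ** ?Q) ** (c' ** ?Q)))"
    by (simp add: sw_rank_coord_proj)
  also have "\<dots> \<le> rank (?P ** M ** ?Q)"
    using rank_mult_le_right rank_mult_le_left order_trans by blast
  finally show ?thesis by (simp add: sw_rank_coord_proj)
qed

text \<open>
  If the southwest rank of \<open>u\<close> at some position exceeds that of \<open>w\<close>, a minor of that size separates the two. It is
  written as a full determinant: the columns \<open>J\<close> of \<open>u\<close> that meet the southwest corner
  are taken from the truncated variable matrix, the others from \<open>u\<close>. At \<open>u\<close> this is \<open>det u \<noteq> 0\<close>,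
  while on \<open>BwB\<close> an invertible matrix of this kind would let the truncation of \<open>u\<close> factor through a
  truncation of smaller rank.
\<close>

lemma perm_mat_in_schubert_variety_imp_bruhat_le:
  fixes u w :: "'n::{finite,linorder} \<Rightarrow> 'n"
  assumes u: "u permutes UNIV" and w: "w permutes UNIV"
    and x: "flag_coset (perm_mat u) \<in> schubert_variety w"
  shows "bruhat_le u w"
proof (rule ccontr)
  assume "\<not> bruhat_le u w"
  then obtain a b where less: "sw_rank (perm_mat w) a b < sw_rank (perm_mat u) a b"
    unfolding bruhat_le_def by (meson not_le)
  let ?P = "coord_proj (\<lambda>i. a \<le> i) :: 'n cmat" and ?Q = "coord_proj (\<lambda>j. j \<le> b) :: 'n cmat"
  (* the columns in which the truncation of u has a nonzero entry *)
  define J where "J = (\<lambda>j. j \<le> b \<and> a \<le> u j)"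
  define M :: "'n cmat \<Rightarrow> 'n cmat" where
    "M Z = (\<chi> i j. if J j then (if a \<le> i then Z $ i $ j else 0) else perm_mat u $ i $ j)" for Z
  have entry: "poly_fun (\<lambda>Z. M Z $ i $ j)" for i j
    by (cases "J j"; cases "a \<le> i") (auto simp: M_def intro: poly_fun.intros)
  have p: "poly_fun (\<lambda>Z. det (M Z))"
    by (rule poly_fun_det) (rule entry)
  have M_proj: "M Z ** coord_proj J = ?P ** Z ** ?Q ** coord_proj J" for Z
    by (auto simp: vec_eq_iff coord_proj_mult_entry mult_coord_proj_entry M_def J_def)
  have trunc_u: "?P ** perm_mat u ** ?Q = perm_mat u ** coord_proj J"
    by (auto simp: vec_eq_iff coord_proj_mult_entry mult_coord_proj_entry J_def perm_mat_def)
  have vanish: "det (M (c ** perm_mat w ** c')) = 0" if "c \<in> borel_upper" "c' \<in> borel_upper" for c c'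
  proof (rule ccontr)
    let ?Z = "c ** perm_mat w ** c'"
    assume "det (M ?Z) \<noteq> 0"
    then obtain N where N: "N ** M ?Z = mat 1"
      unfolding invertible_det_nz[symmetric] invertible_def by blast
    have "?P ** perm_mat u ** ?Q = perm_mat u ** (N ** M ?Z) ** coord_proj J"
      by (simp add: N trunc_u)
    also have "\<dots> = (perm_mat u ** N) ** (M ?Z ** coord_proj J)"
      by (simp add: matrix_mul_assoc)
    also have "\<dots> = (perm_mat u ** N) ** ((?P ** ?Z ** ?Q) ** coord_proj J)"
      by (simp add: M_proj)
    finally have "sw_rank (perm_mat u) a b \<le> rank (?P ** ?Z ** ?Q)"
      using rank_mult_le_right rank_mult_le_left order_trans unfolding sw_rank_coord_proj by metis
    also have "\<dots> \<le> sw_rank (perm_mat w) a b"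
      using sw_rank_borel_le[OF that, of "perm_mat w" a b] by (simp add: sw_rank_coord_proj)
    finally show False using less by simp
  qed
  have "det (M (perm_mat u)) = 0"
    using poly_fun_vanishes_on_schubert_variety[OF w p vanish x] .
  moreover have "M (perm_mat u) = perm_mat u"
    by (auto simp: vec_eq_iff M_def perm_mat_def J_def)
  ultimately show False
    using perm_mat_GL[OF u] by (simp add: GL_def invertible_det_nz)
qed

section \<open>Combinatorics of the Bruhat order\<close>

definition sw_count :: "('n::{finite,linorder} \<Rightarrow> 'n) \<Rightarrow> 'n \<Rightarrow> 'n \<Rightarrow> nat" where
  "sw_count u a b = card {q. q \<le> b \<and> a \<le> u q}"

text \<open>
  The nonzero rows of a truncated permutation matrix are distinct coordinate vectors.
\<close>

lemma sw_rank_perm_mat: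
  fixes u :: "'n::{finite,linorder} \<Rightarrow> 'n"
  assumes u: "u permutes UNIV"
  shows "sw_rank (perm_mat u) a b = sw_count u a b"
proof -
  let ?M = "(\<chi> i j. if a \<le> i \<and> j \<le> b then perm_mat u $ i $ j else 0) :: 'n cmat"
  let ?J = "{q. q \<le> b \<and> a \<le> u q}"
  let ?E = "(\<lambda>q. axis q 1 :: (complex, 'n) vec) ` ?J"
  have row: "row i ?M = (if inv u i \<in> ?J then axis (inv u i) 1 else 0)" for i
    using permutes_inverses[OF u] by (auto simp: vec_eq_iff row_def axis_def perm_mat_def)
  have "vec.span (rows ?M) = vec.span ?E"
  proof
    have "row i ?M \<in> vec.span ?E" for i
      unfolding row by (auto simp: vec.span_zero intro!: vec.span_base imageI)
    then show "vec.span (rows ?M) \<subseteq> vec.span ?E"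
      by (intro vec.span_minimal vec.subspace_span) (auto simp: rows_def)
    have "(axis q 1 :: (complex, 'n) vec) \<in> rows ?M" if "q \<in> ?J" for q
    proof -
      have "axis q 1 = row (u q) ?M"
        using that unfolding row by (simp add: permutes_inverses[OF u])
      then show ?thesis unfolding rows_def by blast
    qed
    then show "vec.span ?E \<subseteq> vec.span (rows ?M)"
      by (intro vec.span_mono) auto
  qed
  moreover have "vec.independent ?E"
    by (rule vec.independent_mono[OF independent_cart_basis]) (auto simp: cart_basis_def)
  ultimately have "vec.dim (rows ?M) = card ?E"
    by (intro vec.dim_eq_card) auto
  also have "card ?E = card ?J"
    by (rule card_image) (auto simp: inj_on_def axis_eq_axis)
  finally show ?thesis by (simp add: sw_rank_def row_rank_def_gen sw_count_def)
qed

lemma bruhat_le_iff_sw_count: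
  assumes "u permutes UNIV" "w permutes UNIV"
  shows "bruhat_le u w \<longleftrightarrow> (\<forall>a b. sw_count u a b \<le> sw_count w a b)"
  by (simp add: bruhat_le_def sw_rank_perm_mat assms)

lemma bruhat_le_trans: "bruhat_le u v \<Longrightarrow> bruhat_le v w \<Longrightarrow> bruhat_le u w"
  unfolding bruhat_le_def using order_trans by blast

text \<open>
  The values are exchanged, but indexed by their positions, because the rank and length formulas compare positions.
\<close>

definition swap_values :: "('n \<Rightarrow> 'n) \<Rightarrow> 'n \<Rightarrow> 'n \<Rightarrow> 'n \<Rightarrow> 'n" where
  "swap_values u j k = Transposition.transpose (u j) (u k) \<circ> u"

lemma swap_values_apply:
  assumes "u permutes UNIV"
  shows "swap_values u j k q = (if q = j then u k else if q = k then u j else u q)"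
  using permutes_inj[OF assms] by (auto simp: swap_values_def transpose_def inj_eq)

lemma swap_values_permutes:
  assumes "u permutes UNIV" shows "swap_values u j k permutes UNIV"
  unfolding swap_values_def using assms by (intro permutes_compose permutes_swap_id) auto

lemma sw_count_sum:
  "sw_count u a b = (\<Sum>q\<in>UNIV. of_bool (q \<le> b \<and> a \<le> u q))"
  by (simp add: sw_count_def sum_of_bool_eq Collect_conj_eq)

lemma sum_split_two:
  fixes f :: "'n::finite \<Rightarrow> 'a::comm_monoid_add"
  assumes "j \<noteq> k"
  shows "(\<Sum>q\<in>UNIV. f q) = f j + f k + (\<Sum>q\<in>UNIV - {j, k}. f q)"
proof -
  have "UNIV = insert j (insert k (UNIV - {j, k}))" by auto
  then have "(\<Sum>q\<in>UNIV. f q) = sum f (insert j (insert k (UNIV - {j, k})))" by simp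
  also have "\<dots> = f j + f k + (\<Sum>q\<in>UNIV - {j, k}. f q)"
    using assms by (simp add: add.assoc)
  finally show ?thesis .
qed

text \<open>
  Exchanging two values that are in increasing order raises the rank function by one on a rectangle
  and leaves it unchanged elsewhere.
\<close>

lemma sw_count_swap_values:
  fixes u :: "'n::{finite,linorder} \<Rightarrow> 'n"
  assumes u: "u permutes UNIV" and jk: "j < k" and uu: "u j < u k"
  shows "sw_count (swap_values u j k) a b
       = sw_count u a b + of_bool (j \<le> b \<and> b < k \<and> u j < a \<and> a \<le> u k)"
proof -
  have "(\<Sum>q\<in>UNIV - {j, k}. of_bool (q \<le> b \<and> a \<le> swap_values u j k q) :: nat)
      = (\<Sum>q\<in>UNIV - {j, k}. of_bool (q \<le> b \<and> a \<le> u q))"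
    by (rule sum.cong) (auto simp: swap_values_apply[OF u])
  then show ?thesis
    using jk uu unfolding sw_count_sum
    by (subst (1 2) sum_split_two[of j k]) (auto simp: swap_values_apply[OF u])
qed

text \<open>
  The rectangle on which the rank function rises is contained in the rectangle of the wider exchange.
\<close>

lemma bruhat_le_swap_values:
  fixes u :: "'n::{finite,linorder} \<Rightarrow> 'n"
  assumes u: "u permutes UNIV" and "j \<le> p" "p < q" "q \<le> k" "u j \<le> u p" "u p < u q" "u q \<le> u k"
  shows "bruhat_le (swap_values u p q) (swap_values u j k)"
proof -
  have "j < k" "u j < u k" using assms by auto
  then show ?thesis
    using assms
    by (simp add: bruhat_le_iff_sw_count swap_values_permutes sw_count_swap_values of_bool_def)
       auto
qed

lemma coxeter_length_sum:
  "int (coxeter_length u) = (\<Sum>p\<in>UNIV. \<Sum>q\<in>UNIV. of_bool (p < q \<and> u q < u p))"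
proof -
  have "int (coxeter_length u) = (\<Sum>z\<in>UNIV. of_bool (z \<in> {(p, q). p < q \<and> u q < u p}))"
    by (simp add: coxeter_length_def sum_of_bool_eq)
  also have "\<dots> = (\<Sum>(p, q)\<in>UNIV \<times> UNIV. of_bool (p < q \<and> u q < u p))"
    by (simp add: case_prod_unfold)
  also have "\<dots> = (\<Sum>p\<in>UNIV. \<Sum>q\<in>UNIV. of_bool (p < q \<and> u q < u p))"
    by (rule sum.cartesian_product[symmetric])
  finally show ?thesis .
qed

text \<open>
  Pairs that avoid \<open>j\<close> and \<open>k\<close> are unaffected, and the pair \<open>(j, k)\<close> becomes an inversion. For every
  other position \<open>p\<close>, the two pairs formed by \<open>p\<close> with \<open>j\<close> and with \<open>k\<close> gain two inversions if \<open>p\<close> lies strictly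
  between \<open>j\<close> and \<open>k\<close> with a value strictly between theirs, and otherwise keep their total.
\<close>

lemma coxeter_length_swap_values:
  fixes u :: "'n::{finite,linorder} \<Rightarrow> 'n"
  assumes u: "u permutes UNIV" and jk: "j < k" and uu: "u j < u k"
  shows "int (coxeter_length (swap_values u j k))
       = int (coxeter_length u) + 1 + 2 * int (card {p. j < p \<and> p < k \<and> u j < u p \<and> u p < u k})"
proof -
  let ?R = "UNIV - {j, k}"
  define f where "f x p q = (of_bool (p < q \<and> x q < x p) :: int)" for x :: "'n \<Rightarrow> 'n" and p q
  let ?u = "swap_values u j k"
  define m where "m x p = f x j p + f x k p + f x p j + f x p k" for x p
  have len: "int (coxeter_length x) = f x j j + f x j k + f x k j + f x k k
      + (\<Sum>p\<in>?R. m x p) + (\<Sum>p\<in>?R. \<Sum>q\<in>?R. f x p q)" for x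
  proof -
    have "int (coxeter_length x) = (\<Sum>p\<in>UNIV. \<Sum>q\<in>UNIV. f x p q)"
      by (simp add: coxeter_length_sum f_def)
    also have "\<dots> = (\<Sum>p\<in>UNIV. f x p j + f x p k + (\<Sum>q\<in>?R. f x p q))"
      using jk by (intro sum.cong refl sum_split_two) auto
    also have "\<dots> = f x j j + f x j k + f x k j + f x k k + (\<Sum>q\<in>?R. f x j q) + (\<Sum>q\<in>?R. f x k q)
        + (\<Sum>p\<in>?R. f x p j + f x p k + (\<Sum>q\<in>?R. f x p q))"
      using jk by (subst sum_split_two[of j k]) auto
    finally show ?thesis by (simp add: m_def sum.distrib)
  qed
  have rest: "(\<Sum>p\<in>?R. \<Sum>q\<in>?R. f ?u p q) = (\<Sum>p\<in>?R. \<Sum>q\<in>?R. f u p q)"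
    by (intro sum.cong refl) (auto simp: f_def swap_values_apply[OF u])
  have "m ?u p = m u p + 2 * of_bool (j < p \<and> p < k \<and> u j < u p \<and> u p < u k)" if "p \<in> ?R" for p
  proof -
    have "u p \<noteq> u j" "u p \<noteq> u k" "p \<noteq> j" "p \<noteq> k"
      using that permutes_inj[OF u] by (auto simp: inj_eq)
    then show ?thesis
      using jk uu by (auto simp: m_def f_def swap_values_apply[OF u])
  qed
  then have "(\<Sum>p\<in>?R. m ?u p)
      = (\<Sum>p\<in>?R. m u p) + 2 * (\<Sum>p\<in>?R. of_bool (j < p \<and> p < k \<and> u j < u p \<and> u p < u k))"
    by (simp add: sum.distrib sum_distrib_left)
  also have "(\<Sum>p\<in>?R. of_bool (j < p \<and> p < k \<and> u j < u p \<and> u p < u k) :: int)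
      = (\<Sum>p\<in>UNIV. of_bool (j < p \<and> p < k \<and> u j < u p \<and> u p < u k))"
    by (rule sum.mono_neutral_left) auto
  also have "\<dots> = int (card {p. j < p \<and> p < k \<and> u j < u p \<and> u p < u k})"
    by (simp add: sum_of_bool_eq)
  finally have mixed: "(\<Sum>p\<in>?R. m ?u p)
      = (\<Sum>p\<in>?R. m u p) + 2 * int (card {p. j < p \<and> p < k \<and> u j < u p \<and> u p < u k})" .
  have "f ?u j j + f ?u j k + f ?u k j + f ?u k k = 1" "f u j j + f u j k + f u k j + f u k k = 0"
    using jk uu by (auto simp: f_def swap_values_apply[OF u])
  then show ?thesis
    using len[of ?u] len[of u] rest mixed by linarith
qed

text \<open>
  Take the first position \<open>j\<close> at which \<open>u\<close> and \<open>w\<close> differ; the rank inequality there forces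
  \<open>u j < w j\<close>. Take the next position \<open>k\<close> whose value lies in \<open>(u j, w j]\<close>. On the rectangle where
  exchanging them raises the rank function there is room: between \<open>j\<close> and \<open>k\<close> no value of \<open>u\<close>
  lies in \<open>(u j, w j]\<close>, so the count for \<open>u\<close> equals the count of values above \<open>w j\<close>, whereas \<open>w\<close>
  additionally has the value \<open>w j\<close> itself.
\<close>

lemma bruhat_le_chain_step:
  fixes u w :: "'n::{finite,linorder} \<Rightarrow> 'n"
  assumes u: "u permutes UNIV" and w: "w permutes UNIV" and le: "bruhat_le u w" and ne: "u \<noteq> w"
  obtains j k where "j < k" "u j < u k" "bruhat_le (swap_values u j k) w"
proof -
  have cle: "sw_count u a b \<le> sw_count w a b" for a b
    using le by (simp add: bruhat_le_iff_sw_count u w)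
  define j where "j = Min {q. u q \<noteq> w q}"
  have D: "{q. u q \<noteq> w q} \<noteq> {}" using ne by auto
  have "j \<in> {q. u q \<noteq> w q}" unfolding j_def by (rule Min_in) (use D in auto)
  then have j: "u j \<noteq> w j" by simp
  have before: "u q = w q" if "q < j" for q
    using that Min_le[of "{q. u q \<noteq> w q}" q] unfolding j_def by (auto simp: not_le[symmetric])
  have count_split: "sw_count x a b = card {q. q < j \<and> a \<le> x q} + card {q. j \<le> q \<and> q \<le> b \<and> a \<le> x q}"
    if "j \<le> b" for x :: "'n \<Rightarrow> 'n" and a b
    unfolding sw_count_def using that
    by (subst card_Un_disjoint[symmetric]) (auto intro!: arg_cong[of _ _ card])
  have same: "{q. q < j \<and> a \<le> u q} = {q. q < j \<and> a \<le> w q}" for a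
    using before by auto
  have tail: "card {q. j \<le> q \<and> q \<le> b \<and> a \<le> u q} \<le> card {q. j \<le> q \<and> q \<le> b \<and> a \<le> w q}"
    if "j \<le> b" for a b
    using cle[of a b] count_split[OF that] by (simp add: same)
  have "u j < w j"
  proof -
    have "{q. j \<le> q \<and> q \<le> j \<and> u j \<le> u q} = {j}" by auto
    then have "{q. j \<le> q \<and> q \<le> j \<and> u j \<le> w q} \<noteq> {}"
      using tail[of j "u j"] by (metis card.empty card_1_singleton_iff not_one_le_zero One_nat_def order_refl)
    then obtain q where "j \<le> q" "q \<le> j" "u j \<le> w q" by blast
    then have "u j \<le> w j" by (metis antisym)
    then show ?thesis using j by auto
  qed
  define K where "K = {q. j < q \<and> u j < u q \<and> u q \<le> w j}"
  obtain k0 where k0: "u k0 = w j" using permutes_surj[OF u] by (metis surjD)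
  have "\<not> k0 < j"
    using before[of k0] k0 permutes_inj[OF w] by (metis injD less_irrefl)
  moreover have "k0 \<noteq> j" using k0 j by auto
  ultimately have "k0 \<in> K" using k0 \<open>u j < w j\<close> by (auto simp: K_def)
  define k where "k = Min K"
  have "k \<in> K" unfolding k_def by (rule Min_in) (use \<open>k0 \<in> K\<close> in auto)
  then have k: "j < k" "u j < u k" "u k \<le> w j" by (auto simp: K_def)
  have gap: "u q \<le> u j \<or> w j < u q" if "j \<le> q" "q < k" for q
  proof (rule ccontr)
    assume "\<not> ?thesis"
    then have "q \<in> K" using that by (auto simp: K_def order.strict_iff_order)
    then have "k \<le> q" unfolding k_def by (intro Min_le) auto
    then show False using that by simp
  qed
  have "sw_count (swap_values u j k) a b \<le> sw_count w a b" for a b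
  proof (cases "j \<le> b \<and> b < k \<and> u j < a \<and> a \<le> u k")
    case False
    then show ?thesis
      using cle[of a b] by (simp only: sw_count_swap_values[OF u k(1,2)] of_bool_def if_False add_0_right)
  next
    case True
    have "card {q. j \<le> q \<and> q \<le> b \<and> a \<le> u q} < card {q. j \<le> q \<and> q \<le> b \<and> a \<le> w q}"
    proof -
      have eq: "{q. j \<le> q \<and> q \<le> b \<and> a \<le> u q} = {q. j \<le> q \<and> q \<le> b \<and> w j < u q}"
        using True k gap by (auto; fastforce)
      (* the rank inequality for the row after w j, if there is one *)
      have "card {q. j \<le> q \<and> q \<le> b \<and> w j < u q} \<le> card {q. j \<le> q \<and> q \<le> b \<and> w j < w q}"
      proof (cases "\<exists>c. w j < c")
        case True
        define c where "c = Min {c. w j < c}"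
        have "c \<in> {c. w j < c}" unfolding c_def by (rule Min_in) (use True in auto)
        moreover have "c \<le> d" if "w j < d" for d
          unfolding c_def using that by (intro Min_le) auto
        ultimately have "w j < d \<longleftrightarrow> c \<le> d" for d by auto
        then show ?thesis using tail[of b c] \<open>j \<le> b \<and> _\<close> by simp
      next
        case False
        then show ?thesis by simp
      qed
      also have "\<dots> < card {q. j \<le> q \<and> q \<le> b \<and> a \<le> w q}"
      proof (rule psubset_card_mono)
        have "a \<le> w j" using True k(3) by (blast intro: order_trans)
        then have "j \<in> {q. j \<le> q \<and> q \<le> b \<and> a \<le> w q}" "j \<notin> {q. j \<le> q \<and> q \<le> b \<and> w j < w q}"
          using True by auto
        moreover have "{q. j \<le> q \<and> q \<le> b \<and> w j < w q} \<subseteq> {q. j \<le> q \<and> q \<le> b \<and> a \<le> w q}"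
          using \<open>a \<le> w j\<close> by (auto intro: order_trans less_imp_le)
        ultimately show "{q. j \<le> q \<and> q \<le> b \<and> w j < w q} \<subset> {q. j \<le> q \<and> q \<le> b \<and> a \<le> w q}"
          by blast
      qed simp
      finally show ?thesis by (simp add: eq)
    qed
    then have "sw_count u a b < sw_count w a b"
      using count_split[of b] True by (simp add: same)
    then show ?thesis using True sw_count_swap_values[OF u k(1,2), of a b] by simp
  qed
  then have "bruhat_le (swap_values u j k) w"
    by (simp add: bruhat_le_iff_sw_count swap_values_permutes u w)
  then show ?thesis using that k by blast
qed

section \<open>Torus-stable curves and torus-fixed points\<close>

text \<open>
  For \<open>i = v k\<close> with \<open>j < k\<close> and \<open>v j < v k\<close> this is the torus-stable curve through the fixed point \<open>v\<close> in the
  direction of the coordinate \<open>z\<^sub>i\<^sub>j\<close>.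
\<close>

definition t_curve :: "('n::{finite,linorder} \<Rightarrow> 'n) \<Rightarrow> 'n \<Rightarrow> 'n \<Rightarrow> complex \<Rightarrow> 'n cmat" where
  "t_curve v i j c = (\<chi> p q. perm_mat v $ p $ q + (if p = i \<and> q = j then c else 0))"

text \<open>
  The factor on the left is an elementary matrix, which adds a multiple of row \<open>i\<close> to row \<open>a\<close>.
\<close>

lemma transvection_mult_entry:
  fixes M :: "'n::finite cmat"
  assumes "a \<noteq> i"
  shows "((\<chi> p q. if p = q then 1 else if p = a \<and> q = i then c else 0) ** M) $ p $ q
       = M $ p $ q + (if p = a then c * M $ i $ q else 0)"
proof -
  have "((\<chi> p q. if p = q then 1 else if p = a \<and> q = i then c else 0) ** M) $ p $ q
      = (\<Sum>k\<in>UNIV. (if k = p then M $ k $ q else 0) + (if k = i then (if p = a then c * M $ k $ q else 0) else 0))"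
    unfolding matrix_matrix_mult_def vec_lambda_beta
    by (rule sum.cong) (use assms in auto)
  then show ?thesis by (simp add: sum.distrib)
qed

text \<open>
  On the rows \<open>v j\<close>, \<open>v k\<close> and the columns \<open>j\<close>, \<open>k\<close> the curve is the matrix with rows \<open>(1, 0)\<close> and
  \<open>(c, 1)\<close>. It is the product of the unipotent matrix with rows \<open>(1, 1/c)\<close> and \<open>(0, 1)\<close> and the matrix
  with rows \<open>(0, -1/c)\<close> and \<open>(c, 1)\<close>; the latter is the antidiagonal permutation matrix times
  the upper triangular matrix with rows \<open>(c, 1)\<close> and \<open>(0, -1/c)\<close>.
\<close>

lemma t_curve_in_borel_orbit:
  fixes v :: "'n::{finite,linorder} \<Rightarrow> 'n"
  assumes v: "v permutes UNIV" and jk: "j < k" and vv: "v j < v k" and c: "c \<noteq> 0"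
  obtains b b' where "b \<in> borel_upper" "b' \<in> borel_upper"
    "t_curve v (v k) j c = b ** perm_mat (swap_values v j k) ** b'"
proof -
  define b :: "'n cmat" where "b = (\<chi> p q. if p = q then 1 else if p = v j \<and> q = v k then 1 / c else 0)"
  define b' :: "'n cmat" where
    "b' = (\<chi> p q. if p = q then if p = j then c else if p = k then - (1 / c) else 1
                  else if p = j \<and> q = k then 1 else 0)"
  have sw: "swap_values v j k permutes UNIV" by (rule swap_values_permutes[OF v])
  have inv_eq: "inv (swap_values v j k) (swap_values v j k q) = q" for q
    by (rule permutes_inverses[OF sw])
  have inv_j: "inv (swap_values v j k) (v j) = k" and inv_k: "inv (swap_values v j k) (v k) = j"
    using inv_eq[of j] inv_eq[of k] jk by (auto simp: swap_values_apply[OF v] split: if_splits)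
  have inv_other: "inv (swap_values v j k) (v q) = q" if "q \<noteq> j" "q \<noteq> k" for q
    using inv_eq[of q] that by (simp add: swap_values_apply[OF v])
  have "b \<in> borel_upper" "b' \<in> borel_upper"
    using jk vv c by (auto simp: borel_upper_iff b_def b'_def)
  moreover have "t_curve v (v k) j c = b ** perm_mat (swap_values v j k) ** b'"
  proof -
    have "t_curve v (v k) j c $ p $ q = (b ** perm_mat (swap_values v j k) ** b') $ p $ q" for p q
    proof -
      obtain r where r: "p = v r" using permutes_surj[OF v] by (metis surjD)
      have veq: "v x = v y \<longleftrightarrow> x = y" for x y using permutes_inj[OF v] by (simp add: inj_eq)
      have "(b ** perm_mat (swap_values v j k) ** b') $ p $ q
          = b' $ inv (swap_values v j k) p $ q + (if p = v j then 1 / c * b' $ j $ q else 0)"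
        unfolding matrix_mul_assoc[symmetric] b_def
        using vv by (subst transvection_mult_entry) (auto simp: perm_mat_mult_matrix_entry[OF sw] inv_k)
      also have "\<dots> = t_curve v (v k) j c $ p $ q"
      proof -
        consider "r = j" | "r = k" | "r \<noteq> j" "r \<noteq> k" by blast
        then show ?thesis
          using jk c
          by cases (auto simp: r b'_def t_curve_def perm_mat_def inv_j inv_k inv_other veq)
      qed
      finally show ?thesis by simp
    qed
    then show ?thesis by (simp add: vec_eq_iff)
  qed
  ultimately show ?thesis using that by blast
qed

lemma left_act_perm_mat_swap:
  assumes "t_curve v (v k) j c = b ** perm_mat (swap_values v j k) ** b'" "b' \<in> borel_upper"
  shows "flag_coset (t_curve v (v k) j c) = left_act b (flag_coset (perm_mat (swap_values v j k)))"
  using assms flag_coset_mult_right by (simp add: left_act_flag_coset)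

lemma t_curve_in_schubert_variety_iff:
  fixes v w :: "'n::{finite,linorder} \<Rightarrow> 'n"
  assumes v: "v permutes UNIV" and w: "w permutes UNIV"
    and jk: "j < k" and vv: "v j < v k" and c: "c \<noteq> 0"
  shows "flag_coset (t_curve v (v k) j c) \<in> schubert_variety w
     \<longleftrightarrow> flag_coset (perm_mat (swap_values v j k)) \<in> schubert_variety w"
proof -
  obtain b b' where b: "b \<in> borel_upper" "b' \<in> borel_upper"
    and eq: "t_curve v (v k) j c = b ** perm_mat (swap_values v j k) ** b'"
    using t_curve_in_borel_orbit[OF v jk vv c] by blast
  obtain d where d: "d \<in> borel_upper" "d ** b = mat 1"
    using borel_upper_inverse[OF b(1)] by metis
  note act = left_act_perm_mat_swap[OF eq b(2)]
  have "flag_coset (perm_mat (swap_values v j k)) = left_act d (flag_coset (t_curve v (v k) j c))"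
    by (simp add: act left_act_flag_coset matrix_mul_assoc d(2))
  then show ?thesis
    using act schubert_variety_left_act[OF w b(1)] schubert_variety_left_act[OF w d(1)] by metis
qed

lemma t_curve_GL:
  fixes v :: "'n::{finite,linorder} \<Rightarrow> 'n"
  assumes v: "v permutes UNIV" and jk: "j < k" and vv: "v j < v k" and c: "c \<noteq> 0"
  shows "t_curve v (v k) j c \<in> GL"
proof -
  obtain b b' where "b \<in> borel_upper" "b' \<in> borel_upper"
    "t_curve v (v k) j c = b ** perm_mat (swap_values v j k) ** b'"
    using t_curve_in_borel_orbit[OF v jk vv c] by blast
  then show ?thesis
    using GL_mult borel_upper_GL perm_mat_GL[OF swap_values_permutes[OF v]] by metis
qed

text \<open>
  Each step up in the Bruhat order increases the sum of all southwest ranks, which is bounded by that of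
  \<open>w\<close>. When the raised permutation is in the Schubert variety, so is the whole curve apart from \<open>u\<close>,
  and then \<open>u\<close> is its limit.
\<close>

lemma bruhat_le_imp_perm_mat_in_schubert_variety:
  fixes u w :: "'n::{finite,linorder} \<Rightarrow> 'n"
  assumes u: "u permutes UNIV" and w: "w permutes UNIV" and le: "bruhat_le u w"
  shows "flag_coset (perm_mat u) \<in> schubert_variety w"
  using u le
proof (induction "(\<Sum>a\<in>UNIV. \<Sum>b\<in>UNIV. sw_count w a b) - (\<Sum>a\<in>UNIV. \<Sum>b\<in>UNIV. sw_count u a b)"
    arbitrary: u rule: less_induct)
  case less
  note u = less.prems(1)
  show ?case
  proof (cases "u = w")
    case True
    have "flag_coset (perm_mat w) \<in> schubert_cell w"
      using flag_coset_schubert_cell[OF one_in_borel_upper one_in_borel_upper, of w] by simp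
    then show ?thesis using True schubert_cell_subset_variety by blast
  next
    case False
    obtain j k where jk: "j < k" "u j < u k" and le: "bruhat_le (swap_values u j k) w"
      using bruhat_le_chain_step[OF u w less.prems(2) False] .
    note sw = swap_values_permutes[OF u, of j k]
    have "(\<Sum>a\<in>UNIV. \<Sum>b\<in>UNIV. sw_count u a b) < (\<Sum>a\<in>UNIV. \<Sum>b\<in>UNIV. sw_count (swap_values u j k) a b)"
    proof (rule sum_strict_mono_ex1)
      show "\<forall>a\<in>UNIV. (\<Sum>b\<in>UNIV. sw_count u a b) \<le> (\<Sum>b\<in>UNIV. sw_count (swap_values u j k) a b)"
        by (auto simp: sw_count_swap_values[OF u jk] intro!: sum_mono)
      show "\<exists>a\<in>UNIV. (\<Sum>b\<in>UNIV. sw_count u a b) < (\<Sum>b\<in>UNIV. sw_count (swap_values u j k) a b)"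
      proof (rule bexI[of _ "u k"], rule sum_strict_mono_ex1)
        show "\<forall>b\<in>UNIV. sw_count u (u k) b \<le> sw_count (swap_values u j k) (u k) b"
          by (simp add: sw_count_swap_values[OF u jk])
        show "\<exists>b\<in>UNIV. sw_count u (u k) b < sw_count (swap_values u j k) (u k) b"
          by (rule bexI[of _ j]) (use jk in \<open>simp_all add: sw_count_swap_values[OF u jk]\<close>)
      qed auto
    qed auto
    moreover have "(\<Sum>a\<in>UNIV. \<Sum>b\<in>UNIV. sw_count (swap_values u j k) a b) \<le> (\<Sum>a\<in>UNIV. \<Sum>b\<in>UNIV. sw_count w a b)"
      using le by (intro sum_mono) (simp add: bruhat_le_iff_sw_count[OF sw w])
    ultimately have "flag_coset (perm_mat (swap_values u j k)) \<in> schubert_variety w"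
      using less.hyps[OF _ sw le] by simp
    then have mem: "flag_coset (t_curve u (u k) j c) \<in> schubert_variety w" if "c \<noteq> 0" for c
      using t_curve_in_schubert_variety_iff[OF u w jk that] by blast
    show ?thesis
    proof (rule schubert_variety_limit[of "at (0::complex)" _ "t_curve u (u k) j"])
      show "perm_mat u \<in> GL" by (rule perm_mat_GL[OF u])
      show "\<forall>\<^sub>F c in at 0. t_curve u (u k) j c \<in> GL \<and> flag_coset (t_curve u (u k) j c) \<in> schubert_variety w"
        unfolding eventually_at_filter using mem t_curve_GL[OF u jk] by (intro always_eventually) auto
      show "((\<lambda>c. t_curve u (u k) j c $ p $ q) \<longlongrightarrow> perm_mat u $ p $ q) (at 0)" for p q
        unfolding t_curve_def by (cases "p = u k \<and> q = j") (auto intro!: tendsto_eq_intros)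
    qed simp
  qed
qed

section \<open>The chart of the opposite cell\<close>

lemma cell_chart_support:
  fixes v :: "'n::{finite,linorder} \<Rightarrow> 'n"
  assumes v: "v permutes UNIV" and Z: "Z \<in> cell_chart v" and ne: "Z $ i $ j \<noteq> 0" and "i \<noteq> v j"
  shows "(i, j) \<in> opp_rothe_diagram v"
proof -
  have i: "i = v (inv v i)" by (simp add: permutes_inverses[OF v])
  have "Z $ i $ j = 0" if "i < v j" using Z that by (simp add: cell_chart_def)
  then have "v j \<le> i" using ne by (meson not_le)
  moreover have "Z $ v (inv v i) $ j = 0" if "inv v i < j" using Z that by (simp add: cell_chart_def)
  then have "j \<le> inv v i" using ne i by (metis not_le)
  moreover have "j \<noteq> inv v i" using i \<open>i \<noteq> v j\<close> by metis
  ultimately show ?thesis using \<open>i \<noteq> v j\<close> by (auto simp: opp_rothe_diagram_def)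
qed

lemma cell_chart_factor:
  fixes v :: "'n::{finite,linorder} \<Rightarrow> 'n"
  assumes v: "v permutes UNIV" and Z: "Z \<in> cell_chart v"
  obtains L where "L \<in> borel_lower" "Z = L ** perm_mat v"
proof -
  define L :: "'n cmat" where "L = (\<chi> r s. Z $ r $ inv v s)"
  have "L $ r $ s = 0" if "r < s" for r s
    using Z that permutes_inverses[OF v] by (simp add: L_def cell_chart_def)
  moreover have "L $ r $ r \<noteq> 0" for r
  proof -
    have "Z $ v (inv v r) $ inv v r = 1" using Z by (simp add: cell_chart_def)
    then show ?thesis by (simp add: L_def permutes_inverses[OF v])
  qed
  ultimately have "L \<in> borel_lower" by (simp add: borel_lower_iff)
  moreover have "Z = L ** perm_mat v"
    by (simp add: vec_eq_iff matrix_mult_perm_mat_entry L_def permutes_inverses[OF v])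
  ultimately show ?thesis using that by blast
qed

lemma cell_chart_GL:
  assumes v: "v permutes UNIV" and Z: "Z \<in> cell_chart v"
  shows "Z \<in> GL"
  using cell_chart_factor[OF assms] GL_mult perm_mat_GL[OF v]
  by (metis (no_types, lifting) borel_lower_def mem_Collect_eq)

lemma cell_chart_in_opp_schubert_cell:
  fixes v :: "'n::{finite,linorder} \<Rightarrow> 'n"
  assumes v: "v permutes UNIV" and Z: "Z \<in> cell_chart v"
  shows "flag_coset Z \<in> opp_schubert_cell v"
proof -
  obtain L where "L \<in> borel_lower" "Z = L ** perm_mat v" using cell_chart_factor[OF assms] .
  then have "flag_coset Z = flag_coset (L ** perm_mat v ** mat 1)" "L \<in> borel_lower" by simp_all
  then show ?thesis unfolding opp_schubert_cell_def using one_in_borel_upper by blast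
qed

text \<open>
  If \<open>Z' = Z b\<close>, the zeros to the right of the pivots of \<open>Z\<close> make row \<open>v c\<close> of \<open>Z'\<close> equal to
  row \<open>c\<close> of \<open>b\<close> as soon as the earlier entries of the column of \<open>b\<close> vanish. Going down each column, the zeros and
  pivots of \<open>Z'\<close> give \<open>b = 1\<close>.
\<close>

lemma cell_chart_unique:
  fixes v :: "'n::{finite,linorder} \<Rightarrow> 'n"
  assumes v: "v permutes UNIV" and Z: "Z \<in> cell_chart v" and Z': "Z' \<in> cell_chart v"
    and eq: "flag_coset Z = flag_coset Z'"
  shows "Z = Z'"
proof -
  obtain b where b: "b \<in> borel_upper" and Z'_eq: "Z' = Z ** b" using flag_coset_eqD[OF eq] .
  have entry: "Z' $ v c $ i = b $ c $ i" if before: "\<And>a. a < c \<Longrightarrow> b $ a $ i = 0" for c i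
  proof -
    have "Z' $ v c $ i = (\<Sum>a\<in>UNIV. Z $ v c $ a * b $ a $ i)"
      by (simp add: Z'_eq matrix_matrix_mult_def)
    also have "\<dots> = (\<Sum>a\<in>{c}. Z $ v c $ a * b $ a $ i)"
    proof (rule sum.mono_neutral_right)
      show "\<forall>a\<in>UNIV - {c}. Z $ v c $ a * b $ a $ i = 0"
      proof
        fix a assume "a \<in> UNIV - {c}"
        then consider "a < c" | "c < a" by (metis Diff_iff linorder_neqE singletonI)
        then show "Z $ v c $ a * b $ a $ i = 0"
          by cases (use before Z in \<open>auto simp: cell_chart_def\<close>)
      qed
    qed auto
    finally show ?thesis using Z by (simp add: cell_chart_def)
  qed
  have zero: "b $ c $ i = 0" if "c < i" for c i
  proof (rule ccontr)
    assume "b $ c $ i \<noteq> 0"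
    define m where "m = Min {a. a < i \<and> b $ a $ i \<noteq> 0}"
    have "m \<in> {a. a < i \<and> b $ a $ i \<noteq> 0}"
      unfolding m_def by (rule Min_in) (use that \<open>b $ c $ i \<noteq> 0\<close> in auto)
    then have m: "m < i" "b $ m $ i \<noteq> 0" by auto
    have "b $ a $ i = 0" if "a < m" for a
    proof (rule ccontr)
      assume "b $ a $ i \<noteq> 0"
      then have "m \<le> a" unfolding m_def using that m(1) by (intro Min_le) auto
      then show False using that by simp
    qed
    then have "Z' $ v m $ i = b $ m $ i" by (rule entry)
    then show False using Z' m by (simp add: cell_chart_def)
  qed
  have one: "b $ i $ i = 1" for i
    using entry[of i i] zero Z' by (simp add: cell_chart_def)
  have "b $ c $ i = (if c = i then 1 else 0)" for c i
  proof -
    consider "c < i" | "c = i" | "i < c" by (metis linorder_neqE)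
    then show ?thesis by cases (use zero one b in \<open>auto simp: borel_upper_iff\<close>)
  qed
  then have "b = mat 1" by (simp add: vec_eq_iff mat_def)
  then show ?thesis using Z'_eq by simp
qed

text \<open>
  Forward substitution: the solution vanishes at all labels before that of \<open>i\<close>.
\<close>

lemma triangular_solve:
  fixes \<phi> :: "'n::finite \<Rightarrow> nat" and A :: "'n cmat"
  assumes inj: "inj \<phi>" and tri: "\<And>a c. \<phi> a < \<phi> c \<Longrightarrow> A $ a $ c = 0" and diag: "\<And>a. A $ a $ a \<noteq> 0"
  obtains x where "A *v x = axis i 1" "\<And>c. \<phi> c < \<phi> i \<Longrightarrow> x $ c = 0"
proof -
  have "det A \<noteq> 0" using diag by (simp add: det_triangular[OF inj tri])
  then obtain A' where "A ** A' = mat 1"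
    unfolding invertible_det_nz[symmetric] invertible_def by blast
  then have sol: "A *v (A' *v axis i 1) = axis i 1"
    by (simp add: matrix_vector_mul_assoc)
  define x where "x = A' *v axis i 1"
  have "x $ c = 0" if "\<phi> c < \<phi> i" for c
    using that
  proof (induction "\<phi> c" arbitrary: c rule: less_induct)
    case less
    have "0 = (A *v x) $ c" using sol less.prems by (auto simp: x_def axis_def)
    also have "\<dots> = (\<Sum>d\<in>UNIV. A $ c $ d * x $ d)" by (simp add: matrix_vector_mult_def)
    also have "\<dots> = (\<Sum>d\<in>{c}. A $ c $ d * x $ d)"
    proof (rule sum.mono_neutral_right)
      show "\<forall>d\<in>UNIV - {c}. A $ c $ d * x $ d = 0"
      proof
        fix d assume "d \<in> UNIV - {c}"
        then have "\<phi> d \<noteq> \<phi> c" using inj by (auto simp: inj_eq)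
        then consider "\<phi> d < \<phi> c" | "\<phi> c < \<phi> d" by linarith
        then show "A $ c $ d * x $ d = 0"
          by cases (use less tri in auto)
      qed
    qed auto
    finally show ?case using diag by simp
  qed
  then show ?thesis using that sol unfolding x_def by blast
qed

text \<open>
  Column operations bring \<open>M = L v\<close> into the normal form. Column \<open>i\<close> of the normal form is
  a combination of the columns \<open>c \<le> i\<close> of \<open>M\<close> with prescribed entries in the rows \<open>v a\<close>, \<open>a \<le> i\<close>. The
  linear system for the coefficients is triangular in the order of the values of \<open>v\<close>, hence
  solvable. By forward substitution only columns with \<open>v c \<ge> v i\<close> occur, so the entries above row
  \<open>v i\<close> remain zero.
\<close>

lemma cell_chart_surj:
  fixes v :: "'n::{finite,linorder} \<Rightarrow> 'n"
  assumes v: "v permutes UNIV" and x: "x \<in> opp_schubert_cell v"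
  obtains Z where "Z \<in> cell_chart v" "flag_coset Z = x"
proof -
  obtain L b0 where L: "L \<in> borel_lower" and "b0 \<in> borel_upper"
    and x_eq0: "x = flag_coset (L ** perm_mat v ** b0)"
    using x unfolding opp_schubert_cell_def by blast
  define M where "M = L ** perm_mat v"
  have x_eq: "x = flag_coset M" using x_eq0 flag_coset_mult_right[OF \<open>b0 \<in> _\<close>] by (simp add: M_def)
  have M_entry: "M $ r $ c = L $ r $ v c" for r c by (simp add: M_def matrix_mult_perm_mat_entry)
  have M_zero: "M $ r $ c = 0" if "r < v c" for r c
    using L that by (simp add: M_entry borel_lower_iff)
  define \<phi> :: "'n \<Rightarrow> nat" where "\<phi> a = card {y. y < v a}" for a
  have inj: "inj \<phi>"
    unfolding \<phi>_def using inj_compose[OF inj_position permutes_inj[OF v]] by (simp add: o_def)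
  have \<phi>_less: "\<phi> a < \<phi> c \<longleftrightarrow> v a < v c" for a c
    unfolding \<phi>_def by (metis strict_mono_position less_asym linorder_neqE less_irrefl)
  (* the system for column i, completed by the identity outside its leading block *)
  define A :: "'n \<Rightarrow> 'n cmat" where
    "A i = (\<chi> a c. if a \<le> i \<and> c \<le> i then M $ v a $ c else if a = c then 1 else 0)" for i
  have "\<exists>y. A i *v y = axis i 1 \<and> (\<forall>c. v c < v i \<longrightarrow> y $ c = 0)" for i
  proof -
    have "A i $ a $ c = 0" if "\<phi> a < \<phi> c" for a c
      using that M_zero by (auto simp: A_def \<phi>_less)
    moreover have "A i $ a $ a \<noteq> 0" for a
      using L by (simp add: A_def M_entry borel_lower_iff)
    ultimately obtain y where "A i *v y = axis i 1" "\<And>c. \<phi> c < \<phi> i \<Longrightarrow> y $ c = 0"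
      using triangular_solve[OF inj, of "A i" i] by blast
    then show ?thesis by (auto simp: \<phi>_less)
  qed
  then obtain y where y: "\<And>i. A i *v y i = axis i 1" and low: "\<And>i c. v c < v i \<Longrightarrow> y i $ c = 0"
    by metis
  have row: "(\<Sum>c\<in>UNIV. A i $ a $ c * y i $ c) = (if a = i then 1 else 0)" for i a
    using arg_cong[OF y[of i], of "\<lambda>z. z $ a"] by (simp add: matrix_vector_mult_def axis_def)
  have high: "y i $ c = 0" if "i < c" for i c
  proof -
    have "(\<Sum>d\<in>UNIV. A i $ c $ d * y i $ d) = (\<Sum>d\<in>UNIV. if d = c then y i $ d else 0)"
      using that by (intro sum.cong) (auto simp: A_def)
    then show ?thesis using row[of i c] that by (auto split: if_splits)
  qed
  have M_row: "(\<Sum>c\<in>UNIV. M $ v a $ c * y i $ c) = (if a = i then 1 else 0)" if "a \<le> i" for i a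
  proof -
    have "(\<Sum>c\<in>UNIV. M $ v a $ c * y i $ c) = (\<Sum>c\<in>UNIV. A i $ a $ c * y i $ c)"
      by (intro sum.cong) (use that high in \<open>auto simp: A_def not_le\<close>)
    then show ?thesis by (simp add: row)
  qed
  define b :: "'n cmat" where "b = (\<chi> c i. y i $ c)"
  have "y i $ i \<noteq> 0" for i
  proof
    assume zero: "y i $ i = 0"
    have "M $ v i $ c * y i $ c = 0" for c
    proof -
      consider "v c < v i" | "c = i" | "v i < v c"
        using permutes_inj[OF v] by (metis injD linorder_neqE)
      then show ?thesis by cases (use low zero M_zero in auto)
    qed
    then have "(\<Sum>c\<in>UNIV. M $ v i $ c * y i $ c) = 0" by (intro sum.neutral ballI)
    then show False using M_row[of i i] by simp
  qed
  then have b: "b \<in> borel_upper" by (simp add: borel_upper_iff b_def high)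
  have Mb: "(M ** b) $ r $ i = (\<Sum>c\<in>UNIV. M $ r $ c * y i $ c)" for r i
    by (simp add: matrix_matrix_mult_def b_def)
  have "(M ** b) $ r $ i = 0" if "r < v i" for r i
  proof -
    have "M $ r $ c * y i $ c = 0" for c
    proof (cases "v c < v i")
      case True
      then show ?thesis using low by simp
    next
      case False
      then have "r < v c" using that by (meson less_le_trans not_less)
      then show ?thesis using M_zero by simp
    qed
    then show ?thesis unfolding Mb by (rule sum.neutral[OF ballI])
  qed
  then have "M ** b \<in> cell_chart v"
    unfolding cell_chart_def by (auto simp: Mb M_row)
  then show ?thesis using that x_eq flag_coset_mult_right[OF b] by metis
qed

lemma t_curve_in_cell_chart:
  fixes v :: "'n::{finite,linorder} \<Rightarrow> 'n"
  assumes v: "v permutes UNIV" and "j < k" "v j < v k"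
  shows "t_curve v (v k) j c \<in> cell_chart v"
  using assms permutes_inj[OF v] by (auto simp: cell_chart_def t_curve_def perm_mat_def inj_eq)

section \<open>The torus action\<close>

definition diag_mat :: "('n::finite \<Rightarrow> complex) \<Rightarrow> 'n cmat" where
  "diag_mat d = (\<chi> i j. if i = j then d i else 0)"

text \<open>
  The formula for \<open>t\<^sup>-\<^sup>1 Z (v\<^sup>-\<^sup>1 t v)\<close> in coordinates, where \<open>t\<close> is the diagonal matrix with entries \<open>d\<close>: the representative in \<open>\<Sigma>\<^sub>v\<close> of the coset of
  \<open>t\<^sup>-\<^sup>1 Z\<close>.
\<close>

definition torus_act :: "('n::finite \<Rightarrow> complex) \<Rightarrow> ('n \<Rightarrow> 'n) \<Rightarrow> 'n cmat \<Rightarrow> 'n cmat" where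
  "torus_act d v Z = (\<chi> i j. d (v j) / d i * Z $ i $ j)"

lemma diag_mat_mult_entry: "(diag_mat d ** M) $ i $ j = d i * M $ i $ j"
proof -
  have "(diag_mat d ** M) $ i $ j = (\<Sum>k\<in>UNIV. if k = i then d i * M $ i $ j else 0)"
    unfolding diag_mat_def matrix_matrix_mult_def vec_lambda_beta by (rule sum.cong) auto
  then show ?thesis by simp
qed

lemma mult_diag_mat_entry: "(M ** diag_mat d) $ i $ j = M $ i $ j * d j"
proof -
  have "(M ** diag_mat d) $ i $ j = (\<Sum>k\<in>UNIV. if k = j then M $ i $ j * d j else 0)"
    unfolding diag_mat_def matrix_matrix_mult_def vec_lambda_beta by (rule sum.cong) auto
  then show ?thesis by simp
qed

lemma diag_mat_inverse:
  assumes "\<And>i. d i \<noteq> 0"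
  shows "diag_mat d ** diag_mat (\<lambda>i. 1 / d i) = mat 1"
  unfolding vec_eq_iff diag_mat_mult_entry using assms by (simp add: diag_mat_def mat_def)

lemma matrix_inv_diag_mat:
  assumes "\<And>i. d i \<noteq> 0"
  shows "matrix_inv (diag_mat d) = diag_mat (\<lambda>i. 1 / d i)"
proof -
  let ?e = "diag_mat (\<lambda>i. 1 / d i)"
  have 1: "diag_mat d ** ?e = mat 1" by (rule diag_mat_inverse[OF assms])
  have 2: "?e ** diag_mat d = mat 1" using 1 matrix_left_right_inverse by blast
  have "diag_mat d ** matrix_inv (diag_mat d) = mat 1 \<and> matrix_inv (diag_mat d) ** diag_mat d = mat 1"
    unfolding matrix_inv_def by (rule someI[of _ ?e]) (use 1 2 in blast)
  then show ?thesis using 2 by (metis matrix_mul_assoc matrix_mul_lid matrix_mul_rid)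
qed

lemma diag_mat_borel_upper:
  fixes d :: "'n::{finite,linorder} \<Rightarrow> complex"
  shows "(\<And>i. d i \<noteq> 0) \<Longrightarrow> diag_mat d \<in> borel_upper"
  by (simp add: borel_upper_iff diag_mat_def)

lemma torus_iff:
  fixes t :: "'n::{finite,linorder} cmat"
  shows "t \<in> torus \<longleftrightarrow> (\<exists>d. (\<forall>i. d i \<noteq> 0) \<and> t = diag_mat d)"
proof
  assume t: "t \<in> torus"
  then have "t \<in> borel_upper" by (auto simp: torus_def borel_upper_def)
  moreover have "t = diag_mat (\<lambda>i. t $ i $ i)" using t by (simp add: vec_eq_iff diag_mat_def torus_def)
  ultimately show "\<exists>d. (\<forall>i. d i \<noteq> 0) \<and> t = diag_mat d" by (auto simp: borel_upper_iff)
next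
  assume "\<exists>d. (\<forall>i. d i \<noteq> 0) \<and> t = diag_mat d"
  then show "t \<in> torus" using diag_mat_borel_upper by (auto simp: torus_def borel_upper_def diag_mat_def)
qed

lemma left_act_inv_diag_mat:
  fixes v :: "'n::{finite,linorder} \<Rightarrow> 'n"
  assumes d: "\<And>i. d i \<noteq> 0"
  shows "left_act (matrix_inv (diag_mat d)) (flag_coset Z) = flag_coset (torus_act d v Z)"
proof -
  have "torus_act d v Z = (diag_mat (\<lambda>i. 1 / d i) ** Z) ** diag_mat (\<lambda>j. d (v j))"
    unfolding vec_eq_iff mult_diag_mat_entry diag_mat_mult_entry by (simp add: torus_act_def)
  then show ?thesis
    using flag_coset_mult_right[OF diag_mat_borel_upper[of "\<lambda>j. d (v j)"]] d
    by (simp add: left_act_flag_coset matrix_inv_diag_mat[OF d])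
qed

definition kl_chart :: "('n::{finite,linorder} \<Rightarrow> 'n) \<Rightarrow> ('n \<Rightarrow> 'n) \<Rightarrow> 'n cmat set" where
  "kl_chart v w = {Z \<in> cell_chart v. flag_coset Z \<in> schubert_variety w}"

lemma kazhdan_lusztig_chart:
  fixes v w :: "'n::{finite,linorder} \<Rightarrow> 'n"
  assumes v: "v permutes UNIV"
  shows "kazhdan_lusztig v w = flag_coset ` kl_chart v w"
proof
  show "kazhdan_lusztig v w \<subseteq> flag_coset ` kl_chart v w"
    using cell_chart_surj[OF v] unfolding kazhdan_lusztig_def kl_chart_def by blast
  show "flag_coset ` kl_chart v w \<subseteq> kazhdan_lusztig v w"
    using cell_chart_in_opp_schubert_cell[OF v] by (auto simp: kazhdan_lusztig_def kl_chart_def)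
qed

lemma torus_act_kl_chart:
  fixes v w :: "'n::{finite,linorder} \<Rightarrow> 'n"
  assumes w: "w permutes UNIV" and d: "\<And>i. d i \<noteq> 0" and Z: "Z \<in> kl_chart v w"
  shows "torus_act d v Z \<in> kl_chart v w"
proof -
  have "torus_act d v Z \<in> cell_chart v"
    using Z d by (simp add: kl_chart_def cell_chart_def torus_act_def)
  moreover have "matrix_inv (diag_mat d) \<in> borel_upper"
    using d by (simp add: matrix_inv_diag_mat[OF d] diag_mat_borel_upper)
  then have "flag_coset (torus_act d v Z) \<in> schubert_variety w"
    using schubert_variety_left_act[OF w] Z left_act_inv_diag_mat[where d=d and Z=Z and v=v, OF d]
    by (metis (no_types, lifting) kl_chart_def mem_Collect_eq)
  ultimately show ?thesis by (simp add: kl_chart_def)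
qed

section \<open>Polyhedral cones\<close>

lemma convex_cone_hull_separation:
  fixes S :: "'a::euclidean_space set"
  assumes "finite S" and notin: "z \<notin> convex_cone hull S"
  obtains a where "a \<bullet> z < 0" "\<And>x. x \<in> convex_cone hull S \<Longrightarrow> 0 \<le> a \<bullet> x"
proof -
  let ?C = "convex_cone hull S"
  have "closed ?C" using \<open>finite S\<close> by (rule closed_convex_cone_hull)
  then obtain a b where ab: "a \<bullet> z < b" "\<forall>x\<in>?C. b < a \<bullet> x"
    using separating_hyperplane_closed_point[OF convex_convex_cone_hull _ notin] by blast
  have "b < 0" using ab(2) convex_cone_hull_contains_0[of S] by force
  have "0 \<le> a \<bullet> x" if "x \<in> ?C" for x
  proof (rule ccontr)
    assume neg: "\<not> 0 \<le> a \<bullet> x"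
    (* the multiple of x at which the functional takes the value b *)
    have "(b / (a \<bullet> x)) *\<^sub>R x \<in> ?C"
      using neg \<open>b < 0\<close> that by (intro convex_cone_hull_mul) (auto simp: divide_nonpos_neg zero_le_divide_iff)
    then show False using ab(2) neg by fastforce
  qed
  moreover have "a \<bullet> z < 0" using ab(1) \<open>b < 0\<close> by simp
  ultimately show ?thesis using that by blast
qed

text \<open>
  A functional \<open>a\<close> separating \<open>r\<close> from the cone of the other generators is negative on \<open>r\<close>; adding the right
  multiple of the positive functional \<open>\<mu>\<close> makes it vanish on \<open>r\<close> and positive on the rest.
\<close>

lemma exposing_functional:
  fixes S :: "'a::euclidean_space set"
  assumes "finite S" and r: "r \<in> S" and irr: "r \<notin> convex_cone hull (S - {r})"
    and \<mu>: "\<And>s. s \<in> S \<Longrightarrow> 0 < \<mu> \<bullet> s"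
  obtains l where "l \<bullet> r = 0" "\<And>s. s \<in> S - {r} \<Longrightarrow> 0 < l \<bullet> s"
proof -
  obtain a where neg: "a \<bullet> r < 0" and nonneg: "\<And>x. x \<in> convex_cone hull (S - {r}) \<Longrightarrow> 0 \<le> a \<bullet> x"
    using convex_cone_hull_separation[OF _ irr] \<open>finite S\<close> by blast
  define t where "t = - (a \<bullet> r) / (\<mu> \<bullet> r)"
  have "0 < t" using \<mu>[OF r] neg by (simp add: t_def divide_neg_pos)
  have "(a + t *\<^sub>R \<mu>) \<bullet> r = 0" using \<mu>[OF r] by (simp only: t_def inner_add_left inner_scaleR_left) simp
  moreover have "0 < (a + t *\<^sub>R \<mu>) \<bullet> s" if "s \<in> S - {r}" for s
    using nonneg[OF hull_inc[OF that]] \<mu>[of s] \<open>0 < t\<close> that by (simp add: inner_add_left add_nonneg_pos)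
  ultimately show ?thesis using that by blast
qed

text \<open>
  The set of vectors satisfying the conclusion is itself a convex cone containing the generators.
\<close>

lemma convex_cone_hull_exposed_ray:
  assumes "l \<bullet> r = 0" and "\<And>s. s \<in> S - {r} \<Longrightarrow> 0 < l \<bullet> s" and "x \<in> convex_cone hull S"
  shows "0 < l \<bullet> x \<or> x \<in> conic hull {r}"
proof -
  let ?K = "{x. 0 < l \<bullet> x \<or> x \<in> conic hull {r}}"
  have ray: "l \<bullet> y = 0" if "y \<in> conic hull {r}" for y
    using that assms(1) by (auto simp: conic_hull_explicit)
  have "convex_cone ?K"
    unfolding convex_cone_iff
  proof (intro conjI ballI allI impI)
    show "0 \<in> ?K" by (auto simp: conic_hull_explicit intro!: exI[of _ 0])
  next
    fix x y assume "x \<in> ?K" "y \<in> ?K"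
    then consider "0 < l \<bullet> x + l \<bullet> y" | "x \<in> conic hull {r}" "y \<in> conic hull {r}"
      using ray[of x] ray[of y] by (auto intro: add_pos_pos)
    then show "x + y \<in> ?K"
    proof cases
      case 1
      then show ?thesis by (simp add: inner_add_right)
    next
      case 2
      then obtain c d where "x = c *\<^sub>R r" "y = d *\<^sub>R r" "0 \<le> c" "0 \<le> d"
        by (auto simp: conic_hull_explicit)
      then have "x + y = (c + d) *\<^sub>R r" "0 \<le> c + d" by (simp_all add: scaleR_left_distrib)
      then show ?thesis by (auto simp: conic_hull_explicit)
    qed
  next
    fix x c assume x: "x \<in> ?K" and c: "0 \<le> (c::real)"
    show "c *\<^sub>R x \<in> ?K"
    proof (cases "c = 0")
      case True
      then show ?thesis by (auto simp: conic_hull_explicit intro!: exI[of _ 0])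
    next
      case False
      then show ?thesis using x c conic_mul[OF conic_conic_hull, of x "{r}" c] by auto
    qed
  qed
  moreover have "S \<subseteq> ?K" using assms(2) by (auto intro: hull_inc)
  ultimately have "convex_cone hull S \<subseteq> ?K" by (intro hull_minimal)
  then show ?thesis using assms(3) by blast
qed

lemma irredundant_generators:
  fixes R :: "'a::euclidean_space set"
  assumes "finite R"
  obtains R0 where "R0 \<subseteq> R" "convex_cone hull R0 = convex_cone hull R"
    "\<And>r. r \<in> R0 \<Longrightarrow> r \<notin> convex_cone hull (R0 - {r})"
proof -
  define P where "P S \<longleftrightarrow> S \<subseteq> R \<and> convex_cone hull S = convex_cone hull R" for S
  have "P R" by (simp add: P_def)
  define R0 where "R0 = arg_min card P"
  have R0: "P R0" and min: "\<And>S. P S \<Longrightarrow> card R0 \<le> card S"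
    using arg_min_nat_lemma[of P R card] \<open>P R\<close> unfolding R0_def by blast+
  have "r \<notin> convex_cone hull (R0 - {r})" if "r \<in> R0" for r
  proof
    assume "r \<in> convex_cone hull (R0 - {r})"
    then have "R0 \<subseteq> convex_cone hull (R0 - {r})" by (auto intro: hull_inc)
    then have "convex_cone hull R0 \<subseteq> convex_cone hull (R0 - {r})"
      by (rule hull_minimal) (rule convex_cone_convex_cone_hull)
    then have "P (R0 - {r})"
      using R0 hull_mono[of "R0 - {r}" R0 convex_cone] unfolding P_def by blast
    moreover have "card (R0 - {r}) < card R0"
      using that R0 \<open>finite R\<close> unfolding P_def by (meson card_Diff1_less finite_subset)
    ultimately show False using min by (meson not_le)
  qed
  then show ?thesis using that R0 unfolding P_def by blast
qed

lemma conic_hull_scaleR: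
  assumes "0 < c" shows "conic hull {c *\<^sub>R u} = conic hull {u}"
proof
  show "conic hull {c *\<^sub>R u} \<subseteq> conic hull {u}"
    by (rule hull_minimal) (use assms in \<open>auto intro: conic_mul conic_conic_hull hull_inc\<close>)
  have "u = (1 / c) *\<^sub>R (c *\<^sub>R u)" using assms by simp
  moreover have "(1 / c) *\<^sub>R (c *\<^sub>R u) \<in> conic hull {c *\<^sub>R u}"
    by (intro conic_mul[OF conic_conic_hull] hull_inc) (use assms in auto)
  ultimately have "u \<in> conic hull {c *\<^sub>R u}" by simp
  then show "conic hull {u} \<subseteq> conic hull {c *\<^sub>R u}"
    by (intro hull_minimal) (auto simp: conic_conic_hull)
qed

text \<open>
  The cone vectors outside a face form, together with zero, a convex cone. If no generator were on
  the face, this cone would be everything.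
\<close>

lemma generator_in_ray_face:
  assumes face: "F face_of (convex_cone hull S)" and "conic F" and u: "u \<in> F" "u \<noteq> 0"
  shows "\<exists>s\<in>S. s \<in> F"
proof (rule ccontr)
  assume none: "\<not> ?thesis"
  let ?C = "convex_cone hull S"
  define K where "K = {x \<in> ?C. x \<notin> F \<or> x = 0}"
  have sum_notin: "x + y \<notin> F" if x: "x \<in> ?C" "x \<notin> F" and y: "y \<in> ?C" for x y
  proof
    assume xy: "x + y \<in> F"
    have mid: "(1/2) *\<^sub>R (x + y) \<in> F" by (rule conic_mul[OF \<open>conic F\<close> xy]) simp
    show False
    proof (cases "x = y")
      case True
      then have "(1/2) *\<^sub>R (x + y) = x" by (simp flip: scaleR_2)
      then show False using mid x by simp
    next
      case False
      then have "(1/2) *\<^sub>R (x + y) \<in> open_segment x y"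
        using midpoint_in_open_segment[of x y] by (simp add: midpoint_def)
      then show False using face_ofD[OF face _ x(1) y mid] x(2) by blast
    qed
  qed
  have "convex_cone K"
    unfolding convex_cone_iff
  proof (intro conjI ballI allI impI)
    show "0 \<in> K" by (simp add: K_def convex_cone_hull_contains_0)
  next
    fix x y assume "x \<in> K" "y \<in> K"
    then show "x + y \<in> K"
      using sum_notin[of x y] by (auto simp: K_def intro: convex_cone_hull_add)
  next
    fix x c assume x: "x \<in> K" and c: "0 \<le> (c::real)"
    show "c *\<^sub>R x \<in> K"
    proof (cases "c = 0 \<or> x = 0")
      case True
      then show ?thesis by (auto simp: K_def convex_cone_hull_contains_0)
    next
      case False
      have "c *\<^sub>R x \<notin> F"
      proof
        assume "c *\<^sub>R x \<in> F"
        then have "(1 / c) *\<^sub>R (c *\<^sub>R x) \<in> F" by (rule conic_mul[OF \<open>conic F\<close>]) (use c in simp)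
        then show False using False x by (simp add: K_def)
      qed
      then show ?thesis using x c by (auto simp: K_def intro: convex_cone_hull_mul)
    qed
  qed
  moreover have "S \<subseteq> K" using none by (auto simp: K_def intro: hull_inc)
  ultimately have "?C \<subseteq> K" by (intro hull_minimal[of S K convex_cone])
  then show False using u face_of_imp_subset[OF face] unfolding K_def by blast
qed

text \<open>
  Each generator spans the face on which its exposing functional vanishes; conversely an extremal ray, being
  a nonzero face, contains a generator.
\<close>

lemma extremal_rays_irredundant:
  fixes W :: "'n::finite rvec set"
  assumes "finite W" and \<mu>: "\<And>u. u \<in> W \<Longrightarrow> 0 < \<mu> \<bullet> u"
    and irr: "\<And>u. u \<in> W \<Longrightarrow> u \<notin> convex_cone hull (W - {u})"
  shows "extremal_rays (convex_cone hull W) = (\<lambda>u. conic hull {u}) ` W"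
proof
  let ?C = "convex_cone hull W"
  show "extremal_rays ?C \<subseteq> (\<lambda>u. conic hull {u}) ` W"
  proof
    fix F assume "F \<in> extremal_rays ?C"
    then obtain u0 where u0: "u0 \<noteq> 0" and F: "F = conic hull {u0}" and face: "F face_of ?C"
      unfolding extremal_rays_def by blast
    have "u0 \<in> F" by (simp add: F hull_inc)
    then obtain u where u: "u \<in> W" "u \<in> F"
      using generator_in_ray_face[OF face _ _ u0] by (auto simp: F conic_conic_hull)
    then obtain c where c: "u = c *\<^sub>R u0" "0 \<le> c" by (auto simp: F conic_hull_explicit)
    moreover have "c \<noteq> 0" using c \<mu>[OF u(1)] by auto
    ultimately have "conic hull {u} = F" unfolding F using conic_hull_scaleR[of c u0] by simp
    then show "F \<in> (\<lambda>u. conic hull {u}) ` W" using u by blast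
  qed
  show "(\<lambda>u. conic hull {u}) ` W \<subseteq> extremal_rays ?C"
  proof
    fix F assume "F \<in> (\<lambda>u. conic hull {u}) ` W"
    then obtain u where u: "u \<in> W" and F: "F = conic hull {u}" by blast
    obtain l where l: "l \<bullet> u = 0" "\<And>s. s \<in> W - {u} \<Longrightarrow> 0 < l \<bullet> s"
      using exposing_functional[OF \<open>finite W\<close> u irr[OF u] \<mu>] by blast
    have exposed: "0 < l \<bullet> x \<or> x \<in> F" if "x \<in> ?C" for x
      using convex_cone_hull_exposed_ray[OF l that] by (simp add: F)
    have F0: "l \<bullet> x = 0" if "x \<in> F" for x using that l(1) by (auto simp: F conic_hull_explicit)
    have "F \<subseteq> ?C"
      unfolding F by (rule hull_minimal) (use u in \<open>auto intro: hull_inc conic_convex_cone_hull\<close>)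
    then have "F = ?C \<inter> {x. l \<bullet> x = 0}" using exposed F0 by force
    moreover have "?C \<inter> {x. l \<bullet> x = 0} face_of ?C"
      by (rule face_of_Int_supporting_hyperplane_ge[OF convex_convex_cone_hull])
         (use exposed F0 in force)
    ultimately show "F \<in> extremal_rays ?C"
      using \<mu>[OF u] F unfolding extremal_rays_def by force
  qed
qed

section \<open>Weights of the coordinate ring\<close>

text \<open>
  The positions \<open>(v j, j)\<close> are excluded because the entry there is the constant \<open>1\<close>, of weight zero.
\<close>

definition kl_roots :: "('n::{finite,linorder} \<Rightarrow> 'n) \<Rightarrow> ('n \<Rightarrow> 'n) \<Rightarrow> 'n rvec set" where
  "kl_roots v w = {coordinate_weight v i j |i j. i \<noteq> v j \<and> (\<exists>Z\<in>kl_chart v w. Z $ i $ j \<noteq> 0)}"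

lemma finite_kl_roots: "finite (kl_roots v w)"
proof (rule finite_subset)
  show "kl_roots v w \<subseteq> (\<lambda>(i, j). coordinate_weight v i j) ` UNIV" by (auto simp: kl_roots_def)
qed simp

lemma inner_coordinate_weight: "l \<bullet> coordinate_weight v i j = l $ v j - l $ i"
  by (simp add: coordinate_weight_def inner_diff_right inner_axis)

lemma kl_roots_nonneg_inner:
  assumes "\<And>s. s \<in> kl_roots v w \<Longrightarrow> 0 \<le> l \<bullet> s" and "Z \<in> kl_chart v w" and "Z $ i $ j \<noteq> 0"
  shows "0 \<le> l \<bullet> coordinate_weight v i j"
proof (cases "i = v j")
  case True
  then show ?thesis by (simp add: inner_coordinate_weight)
next
  case False
  then show ?thesis using assms unfolding kl_roots_def by blast
qed

text \<open>
  Minus signs are chosen so that the coordinate of weight \<open>r\<close> is scaled by \<open>exp (- t (l \<bullet> r))\<close> and limits are taken for \<open>t\<close> going to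
  infinity. Since the torus contains all invertible diagonal matrices, \<open>l\<close> can be any real vector.
\<close>

definition flow :: "real^'n::finite \<Rightarrow> real \<Rightarrow> 'n \<Rightarrow> complex" where
  "flow l t i = of_real (exp (- (t * l $ i)))"

lemma flow_nonzero: "flow l t i \<noteq> 0"
  by (simp add: flow_def)

lemma torus_act_flow_entry:
  "torus_act (flow l t) v Z $ i $ j = of_real (exp (- (t * (l \<bullet> coordinate_weight v i j)))) * Z $ i $ j"
proof -
  have "flow l t (v j) / flow l t i = of_real (exp (- (t * (l \<bullet> coordinate_weight v i j))))"
    unfolding flow_def of_real_divide[symmetric] exp_diff[symmetric] inner_coordinate_weight
    by (simp add: algebra_simps)
  then show ?thesis by (simp only: torus_act_def vec_lambda_beta)
qed

lemma flow_limit: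
  fixes Z :: "'n::{finite,linorder} cmat"
  assumes nonneg: "Z $ i $ j \<noteq> 0 \<Longrightarrow> 0 \<le> l \<bullet> coordinate_weight v i j"
  shows "((\<lambda>t. torus_act (flow l t) v Z $ i $ j)
     \<longlongrightarrow> (if l \<bullet> coordinate_weight v i j = 0 then Z $ i $ j else 0)) at_top"
proof -
  let ?a = "l \<bullet> coordinate_weight v i j"
  consider "Z $ i $ j = 0" | "?a = 0" | "0 < ?a" using nonneg by fastforce
  then show ?thesis
  proof cases
    case 3
    have "filterlim (\<lambda>t. ?a * t) at_top at_top"
      by (rule filterlim_tendsto_pos_mult_at_top[OF tendsto_const 3 filterlim_ident])
    then have "((\<lambda>t. exp (- (t * ?a))) \<longlongrightarrow> 0) at_top"
      by (intro filterlim_compose[OF exp_at_bot]) (simp add: filterlim_uminus_at_bot mult.commute)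
    then have "((\<lambda>t. of_real (exp (- (t * ?a))) * Z $ i $ j) \<longlongrightarrow> of_real 0 * Z $ i $ j) at_top"
      by (intro tendsto_intros)
    then show ?thesis using 3 by (simp add: torus_act_flow_entry)
  qed (simp_all add: torus_act_flow_entry)
qed

text \<open>
  Degeneration of a point onto the face of the roots cut out by \<open>l\<close>.
\<close>

lemma flow_limit_in_kl_chart:
  fixes v w :: "'n::{finite,linorder} \<Rightarrow> 'n"
  assumes v: "v permutes UNIV" and w: "w permutes UNIV" and Z: "Z \<in> kl_chart v w"
    and nonneg: "\<And>s. s \<in> kl_roots v w \<Longrightarrow> 0 \<le> l \<bullet> s"
  shows "(\<chi> i j. if l \<bullet> coordinate_weight v i j = 0 then Z $ i $ j else 0) \<in> kl_chart v w"
    (is "?Z \<in> _")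
proof -
  have chart: "?Z \<in> cell_chart v"
    using Z by (auto simp: kl_chart_def cell_chart_def inner_coordinate_weight)
  have "flag_coset ?Z \<in> schubert_variety w"
  proof (rule schubert_variety_limit[of at_top _ "\<lambda>t. torus_act (flow l t) v Z"])
    show "?Z \<in> GL" by (rule cell_chart_GL[OF v chart])
    have "torus_act (flow l t) v Z \<in> kl_chart v w" for t
      by (rule torus_act_kl_chart[OF w flow_nonzero Z])
    then show "\<forall>\<^sub>F t in at_top. torus_act (flow l t) v Z \<in> GL \<and>
        flag_coset (torus_act (flow l t) v Z) \<in> schubert_variety w"
      using cell_chart_GL[OF v] by (auto simp: kl_chart_def)
    show "((\<lambda>t. torus_act (flow l t) v Z $ i $ j) \<longlongrightarrow> ?Z $ i $ j) at_top" for i j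
      using flow_limit[of Z i j l v] kl_roots_nonneg_inner[OF nonneg Z] by simp
  qed simp
  then show ?thesis using chart by (simp add: kl_chart_def)
qed

lemma character_diag_mat: "character m (diag_mat d) = (\<Prod>i\<in>UNIV. d i powi m i)"
  by (simp add: character_def diag_mat_def)

lemma character_flow:
  "character m (diag_mat (flow l t)) = of_real (exp (- (t * (l \<bullet> char_vec m))))"
proof -
  have "flow l t i powi m i = of_real (exp (- (t * (l $ i * of_int (m i)))))" for i
    unfolding flow_def of_real_power_int[symmetric] exp_power_int by (simp add: algebra_simps)
  then have "character m (diag_mat (flow l t)) = of_real (\<Prod>i\<in>UNIV. exp (- (t * (l $ i * of_int (m i)))))"
    by (simp add: character_diag_mat)
  also have "(\<Prod>i\<in>UNIV. exp (- (t * (l $ i * of_int (m i))))) = exp (- (t * (l \<bullet> char_vec m)))"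
    by (simp add: exp_sum[symmetric] sum_negf inner_vec_def char_vec_def sum_distrib_left)
  finally show ?thesis .
qed

text \<open>
  A function of a weight \<open>m\<close> outside the cone would be scaled by a factor tending to infinity along a flow
  under which the point, and with it the value of the polynomial representing the function, converges.
\<close>

lemma kl_weights_subset_cone:
  fixes v w :: "'n::{finite,linorder} \<Rightarrow> 'n"
  assumes v: "v permutes UNIV" and w: "w permutes UNIV"
  shows "kl_weights v w \<subseteq> convex_cone hull kl_roots v w"
proof (rule subsetI, rule ccontr)
  fix x assume "x \<in> kl_weights v w" and notin: "x \<notin> convex_cone hull kl_roots v w"
  then obtain m f where x: "x = char_vec m" and f: "kl_regular v w f"
    and nz: "\<exists>x\<in>kazhdan_lusztig v w. f x \<noteq> 0"
    and equi: "\<And>t x. t \<in> torus \<Longrightarrow> x \<in> kazhdan_lusztig v w \<Longrightarrow>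
        f (left_act (matrix_inv t) x) = character m t * f x"
    unfolding kl_weights_def by blast
  obtain Z where Z: "Z \<in> kl_chart v w" and fZ: "f (flag_coset Z) \<noteq> 0"
    using nz by (auto simp: kazhdan_lusztig_chart[OF v])
  obtain p where "poly_fun p" and p: "\<And>Z. Z \<in> kl_chart v w \<Longrightarrow> f (flag_coset Z) = p Z"
    using f kazhdan_lusztig_chart[OF v, of w] unfolding kl_regular_def kl_chart_def by blast
  obtain l where neg: "l \<bullet> char_vec m < 0"
    and pos: "\<And>y. y \<in> convex_cone hull kl_roots v w \<Longrightarrow> 0 \<le> l \<bullet> y"
    using convex_cone_hull_separation[OF finite_kl_roots notin] unfolding x by blast
  have nonneg: "0 \<le> l \<bullet> s" if "s \<in> kl_roots v w" for s
    using pos that by (simp add: hull_inc)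
  define Z' where "Z' = (\<chi> i j. if l \<bullet> coordinate_weight v i j = 0 then Z $ i $ j else 0)"
  have "((\<lambda>t. p (torus_act (flow l t) v Z)) \<longlongrightarrow> p Z') at_top"
    using \<open>poly_fun p\<close>
  proof (rule tendsto_poly_fun)
    show "((\<lambda>t. torus_act (flow l t) v Z $ i $ j) \<longlongrightarrow> Z' $ i $ j) at_top" for i j
      using flow_limit[of Z i j l v] kl_roots_nonneg_inner[OF nonneg Z] by (simp add: Z'_def)
  qed
  moreover have "p (torus_act (flow l t) v Z) = of_real (exp (- (t * (l \<bullet> char_vec m)))) * f (flag_coset Z)" for t
  proof -
    have "diag_mat (flow l t) \<in> torus" using flow_nonzero torus_iff by blast
    then have "f (flag_coset (torus_act (flow l t) v Z)) = character m (diag_mat (flow l t)) * f (flag_coset Z)"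
      using equi[of "diag_mat (flow l t)" "flag_coset Z"] Z
      by (simp add: kazhdan_lusztig_chart[OF v] left_act_inv_diag_mat[where v = v, OF flow_nonzero])
    then show ?thesis
      using p[OF torus_act_kl_chart[where d = "flow l t", OF w flow_nonzero Z]]
      by (simp add: character_flow)
  qed
  ultimately have "((\<lambda>t. of_real (exp (- (t * (l \<bullet> char_vec m)))) * f (flag_coset Z)) \<longlongrightarrow> p Z') at_top"
    by simp
  then have "((\<lambda>t. of_real (exp (- (t * (l \<bullet> char_vec m)))) * f (flag_coset Z) / f (flag_coset Z))
      \<longlongrightarrow> p Z' / f (flag_coset Z)) at_top"
    by (intro tendsto_intros fZ)
  then have "((\<lambda>t. complex_of_real (exp (- (t * (l \<bullet> char_vec m))))) \<longlongrightarrow> p Z' / f (flag_coset Z)) at_top"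
    using fZ by simp
  then have "((\<lambda>t. norm (complex_of_real (exp (- (t * (l \<bullet> char_vec m)))))) \<longlongrightarrow> norm (p Z' / f (flag_coset Z))) at_top"
    by (rule tendsto_norm)
  then have "((\<lambda>t. exp (- (t * (l \<bullet> char_vec m)))) \<longlongrightarrow> norm (p Z' / f (flag_coset Z))) at_top"
    by simp
  moreover have "filterlim (\<lambda>t. exp (- (t * (l \<bullet> char_vec m)))) at_top at_top"
  proof (rule filterlim_compose[OF exp_at_top])
    have "filterlim (\<lambda>t. (- (l \<bullet> char_vec m)) * t) at_top at_top"
      by (rule filterlim_tendsto_pos_mult_at_top[OF tendsto_const _ filterlim_ident]) (use neg in simp)
    then show "filterlim (\<lambda>t. - (t * (l \<bullet> char_vec m))) at_top at_top" by (simp add: mult.commute)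
  qed
  ultimately show False
    using not_tendsto_and_filterlim_at_infinity[of at_top] filterlim_at_top_imp_at_infinity
    by (metis trivial_limit_at_top_linorder)
qed

lemma char_vec_root:
  "char_vec (\<lambda>k. of_bool (k = v j) - of_bool (k = i)) = coordinate_weight v i j"
  by (auto simp: vec_eq_iff char_vec_def coordinate_weight_def axis_def)

text \<open>
  The weight vector is the coordinate function itself, read off from the unique representative
  in the chart.
\<close>

lemma kl_roots_subset_weights:
  fixes v w :: "'n::{finite,linorder} \<Rightarrow> 'n"
  assumes v: "v permutes UNIV" and w: "w permutes UNIV"
  shows "kl_roots v w \<subseteq> kl_weights v w"
proof
  fix x assume "x \<in> kl_roots v w"
  then obtain i j Z0 where x: "x = coordinate_weight v i j" and "i \<noteq> v j"
    and Z0: "Z0 \<in> kl_chart v w" "Z0 $ i $ j \<noteq> 0"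
    unfolding kl_roots_def by blast
  define m where "m = (\<lambda>k. of_bool (k = v j) - of_bool (k = i) :: int)"
  define f where "f y = (THE Z. Z \<in> cell_chart v \<and> flag_coset Z = y) $ i $ j" for y :: "'n cmat set"
  have f: "f (flag_coset Z) = Z $ i $ j" if "Z \<in> cell_chart v" for Z
  proof -
    have "(THE Z'. Z' \<in> cell_chart v \<and> flag_coset Z' = flag_coset Z) = Z"
      using that cell_chart_unique[OF v] by (intro the_equality) auto
    then show ?thesis by (simp add: f_def)
  qed
  have char: "character m (diag_mat d) = d (v j) / d i" if "\<And>k. d k \<noteq> 0" for d
  proof -
    have "d k powi m k = (if k = v j then d k else 1) * (if k = i then 1 / d k else 1)" for k
      using that \<open>i \<noteq> v j\<close> by (auto simp: m_def power_int_minus field_simps)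
    then show ?thesis by (simp add: character_diag_mat prod.distrib)
  qed
  have "kl_regular v w f"
    unfolding kl_regular_def by (intro exI[of _ "\<lambda>Z. Z $ i $ j"]) (simp add: f poly_fun.entry)
  moreover have "\<exists>y\<in>kazhdan_lusztig v w. f y \<noteq> 0"
    using Z0 f by (auto simp: kazhdan_lusztig_chart[OF v] kl_chart_def)
  moreover have "f (left_act (matrix_inv t) y) = character m t * f y"
    if t: "t \<in> torus" and y: "y \<in> kazhdan_lusztig v w" for t y
  proof -
    obtain d where d: "\<And>k. d k \<noteq> 0" and t: "t = diag_mat d" using t torus_iff by blast
    obtain Z where Z: "Z \<in> kl_chart v w" and y: "y = flag_coset Z"
      using y kazhdan_lusztig_chart[OF v] by blast
    have "torus_act d v Z \<in> cell_chart v" "Z \<in> cell_chart v"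
      using torus_act_kl_chart[OF w d Z] Z by (simp_all add: kl_chart_def)
    then show ?thesis
      by (simp add: t y left_act_inv_diag_mat[where v = v, OF d] f char[OF d] torus_act_def)
  qed
  ultimately show "x \<in> kl_weights v w"
    unfolding kl_weights_def x char_vec_root[symmetric] m_def by blast
qed

lemma weight_cone_eq:
  fixes v w :: "'n::{finite,linorder} \<Rightarrow> 'n"
  assumes "v permutes UNIV" and "w permutes UNIV"
  shows "weight_cone v w = convex_cone hull kl_roots v w"
proof
  show "weight_cone v w \<subseteq> convex_cone hull kl_roots v w"
    unfolding weight_cone_def
    by (rule hull_minimal) (rule kl_weights_subset_cone[OF assms], rule convex_cone_convex_cone_hull)
  show "convex_cone hull kl_roots v w \<subseteq> weight_cone v w"
    unfolding weight_cone_def by (rule hull_mono[OF kl_roots_subset_weights[OF assms]])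
qed

section \<open>The extremal rays\<close>

text \<open>
  The pairs \<open>(j, k)\<close> of positions replace the pairs \<open>(i, j)\<close> of the opposite Rothe diagram, with \<open>i = v k\<close>. The length
  condition is expressed by the absence of an intermediate position with an intermediate value.
\<close>

definition cover_roots :: "('n::{finite,linorder} \<Rightarrow> 'n) \<Rightarrow> ('n \<Rightarrow> 'n) \<Rightarrow> 'n rvec set" where
  "cover_roots v w = {coordinate_weight v (v k) j |j k. j < k \<and> v j < v k \<and>
     bruhat_le (swap_values v j k) w \<and> (\<forall>p. j < p \<longrightarrow> p < k \<longrightarrow> \<not> (v j < v p \<and> v p < v k))}"

lemma kl_roots_cases:
  fixes v w :: "'n::{finite,linorder} \<Rightarrow> 'n"
  assumes v: "v permutes UNIV" and "r \<in> kl_roots v w"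
  obtains j k Z where "j < k" "v j < v k" "r = coordinate_weight v (v k) j"
    "Z \<in> kl_chart v w" "Z $ v k $ j \<noteq> 0"
proof -
  obtain i j Z where ij: "r = coordinate_weight v i j" "i \<noteq> v j" "Z \<in> kl_chart v w" "Z $ i $ j \<noteq> 0"
    using assms(2) unfolding kl_roots_def by blast
  then have "(i, j) \<in> opp_rothe_diagram v"
    using cell_chart_support[OF v] by (auto simp: kl_chart_def)
  then show ?thesis
    using that[of j "inv v i" Z] ij by (simp add: opp_rothe_diagram_def permutes_inverses[OF v])
qed

lemma bruhat_le_imp_kl_root:
  fixes v w :: "'n::{finite,linorder} \<Rightarrow> 'n"
  assumes v: "v permutes UNIV" and w: "w permutes UNIV" and jk: "j < k" "v j < v k"
    and le: "bruhat_le (swap_values v j k) w"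
  shows "coordinate_weight v (v k) j \<in> kl_roots v w"
proof -
  have "flag_coset (t_curve v (v k) j 1) \<in> schubert_variety w"
    using t_curve_in_schubert_variety_iff[OF v w jk, of 1]
      bruhat_le_imp_perm_mat_in_schubert_variety[OF swap_values_permutes[OF v] w le] by simp
  then have "t_curve v (v k) j 1 \<in> kl_chart v w"
    using t_curve_in_cell_chart[OF v jk] by (simp add: kl_chart_def)
  moreover have "t_curve v (v k) j 1 $ v k $ j \<noteq> 0"
    using jk by (auto simp: t_curve_def perm_mat_def)
  moreover have "v k \<noteq> v j" using jk by simp
  ultimately show ?thesis unfolding kl_roots_def by blast
qed

text \<open>
  Distinct free coordinates have distinct weights, which is what allows a flow to isolate one of them.
\<close>

lemma coordinate_weight_inject:
  fixes v :: "'n::{finite,linorder} \<Rightarrow> 'n"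
  assumes v: "v permutes UNIV" and "i \<noteq> v j"
    and eq: "coordinate_weight v i j = coordinate_weight v p q"
  shows "p = i \<and> q = j"
proof -
  have "(if x = v j then 1 else 0) - (if x = i then 1 else 0)
      = (if x = v q then 1 else 0) - (if x = p then 1 else (0::real))" for x
    using arg_cong[OF eq, of "\<lambda>u. u $ x"] by (simp add: coordinate_weight_def axis_def)
  from this[of "v j"] this[of i] have "v q = v j" "p = i"
    using \<open>i \<noteq> v j\<close> by (auto split: if_splits)
  then show ?thesis using permutes_inj[OF v] by (simp add: inj_eq)
qed

text \<open>
  The flow along \<open>l\<close> kills all free coordinates except the one with weight \<open>r\<close>, and its limit is
  a point of the torus-stable curve other than \<open>v\<close>. An intermediate value \<open>v p\<close> would give two further
  roots with sum \<open>r\<close>, on both of which \<open>l\<close> is positive.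
\<close>

lemma exposed_kl_root_is_cover_root:
  fixes v w :: "'n::{finite,linorder} \<Rightarrow> 'n"
  assumes v: "v permutes UNIV" and w: "w permutes UNIV" and r: "r \<in> kl_roots v w"
    and l0: "l \<bullet> r = 0" and lpos: "\<And>s. s \<in> kl_roots v w - {r} \<Longrightarrow> 0 < l \<bullet> s"
  shows "r \<in> cover_roots v w"
proof -
  obtain j k Z where jk: "j < k" "v j < v k" and r_eq: "r = coordinate_weight v (v k) j"
    and Z: "Z \<in> kl_chart v w" and ne: "Z $ v k $ j \<noteq> 0"
    using kl_roots_cases[OF v r] .
  have nonneg: "0 \<le> l \<bullet> s" if "s \<in> kl_roots v w" for s
    using lpos[of s] l0 that by (cases "s = r") auto
  have "(\<chi> i j. if l \<bullet> coordinate_weight v i j = 0 then Z $ i $ j else 0) = t_curve v (v k) j (Z $ v k $ j)"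
  proof -
    have "(if l \<bullet> coordinate_weight v p q = 0 then Z $ p $ q else 0)
        = perm_mat v $ p $ q + (if p = v k \<and> q = j then Z $ v k $ j else 0)" for p q
    proof -
      consider "p = v q" | "p = v k" "q = j" | "p \<noteq> v q" "\<not> (p = v k \<and> q = j)" by blast
      then show ?thesis
      proof cases
        case 1
        moreover have "\<not> (v q = v k \<and> q = j)" using jk by auto
        ultimately show ?thesis
          using Z by (auto simp: kl_chart_def cell_chart_def perm_mat_def inner_coordinate_weight)
      next
        case 2
        then show ?thesis using l0 jk by (auto simp: r_eq perm_mat_def)
      next
        case 3
        have "Z $ p $ q = 0" if zero: "l \<bullet> coordinate_weight v p q = 0"
        proof (rule ccontr)
          assume "Z $ p $ q \<noteq> 0"
          then have "coordinate_weight v p q \<in> kl_roots v w"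
            using 3 Z unfolding kl_roots_def by blast
          then have "coordinate_weight v p q = r" using lpos zero by fastforce
          then have "v k = p \<and> j = q" using coordinate_weight_inject[OF v] 3 r_eq by metis
          then show False using 3 by simp
        qed
        then show ?thesis using 3 by (auto simp: perm_mat_def)
      qed
    qed
    then show ?thesis by (simp add: t_curve_def vec_eq_iff)
  qed
  then have "t_curve v (v k) j (Z $ v k $ j) \<in> kl_chart v w"
    using flow_limit_in_kl_chart[OF v w Z nonneg] by simp
  then have "flag_coset (perm_mat (swap_values v j k)) \<in> schubert_variety w"
    using t_curve_in_schubert_variety_iff[OF v w jk ne] by (simp add: kl_chart_def)
  then have le: "bruhat_le (swap_values v j k) w"
    by (rule perm_mat_in_schubert_variety_imp_bruhat_le[OF swap_values_permutes[OF v] w])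
  have "\<not> (v j < v p \<and> v p < v k)" if p: "j < p" "p < k" for p
  proof
    assume vp: "v j < v p \<and> v p < v k"
    have "coordinate_weight v (v p) j \<in> kl_roots v w"
      using p vp le bruhat_le_swap_values[OF v, of j j p k] bruhat_le_trans
      by (intro bruhat_le_imp_kl_root[OF v w]) (auto intro: less_imp_le)
    moreover have "coordinate_weight v (v k) p \<in> kl_roots v w"
      using p vp le bruhat_le_swap_values[OF v, of j p k k] bruhat_le_trans
      by (intro bruhat_le_imp_kl_root[OF v w]) (auto intro: less_imp_le)
    moreover have "coordinate_weight v (v p) j \<noteq> r" "coordinate_weight v (v k) p \<noteq> r"
      using coordinate_weight_inject[OF v, of "v k" j] jk p vp unfolding r_eq by (metis less_irrefl)+
    ultimately have "0 < l \<bullet> coordinate_weight v (v p) j" "0 < l \<bullet> coordinate_weight v (v k) p"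
      using lpos by auto
    then show False using l0 by (simp add: r_eq inner_coordinate_weight)
  qed
  then show ?thesis using jk le r_eq unfolding cover_roots_def by blast
qed

text \<open>
  The separating functional is the indicator of the values that precede or equal \<open>v k\<close> in both value and position,
  except \<open>v j\<close>. It is nonnegative on a root from \<open>v p\<close> to \<open>v q\<close> unless \<open>v q\<close> is in this set and
  \<open>v p\<close> is not. Then \<open>p = j\<close>, and since nothing lies between \<open>j\<close> and \<open>k\<close>, also \<open>q = k\<close>.
\<close>

lemma cover_root_irredundant:
  fixes v w :: "'n::{finite,linorder} \<Rightarrow> 'n"
  assumes v: "v permutes UNIV" and u: "u \<in> cover_roots v w"
  shows "u \<notin> convex_cone hull (cover_roots v w - {u})"
proof
  assume mem: "u \<in> convex_cone hull (cover_roots v w - {u})"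
  obtain j k where jk: "j < k" "v j < v k" and u_eq: "u = coordinate_weight v (v k) j"
    and cover: "\<And>p. j < p \<Longrightarrow> p < k \<Longrightarrow> \<not> (v j < v p \<and> v p < v k)"
    using u unfolding cover_roots_def by blast
  define l :: "'n rvec" where
    "l = (\<chi> x. if x \<le> v k \<and> inv v x \<le> k \<and> x \<noteq> v j then 1 else 0)"
  have l: "l $ v q = (if v q \<le> v k \<and> q \<le> k \<and> q \<noteq> j then 1 else 0)" for q
    using permutes_inj[OF v] by (auto simp: l_def permutes_inverses[OF v] inj_eq)
  have "cover_roots v w - {u} \<subseteq> {x. 0 \<le> l \<bullet> x}"
  proof
    fix s assume s: "s \<in> cover_roots v w - {u}"
    then obtain p q where pq: "p < q" "v p < v q" and s_eq: "s = coordinate_weight v (v q) p"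
      unfolding cover_roots_def by blast
    have "l $ v q \<le> l $ v p"
    proof (rule ccontr)
      assume "\<not> ?thesis"
      then have q: "v q \<le> v k" "q \<le> k" "q \<noteq> j" and np: "\<not> (v p \<le> v k \<and> p \<le> k \<and> p \<noteq> j)"
        by (auto simp: l split: if_splits)
      have "v p \<le> v k" "p \<le> k" using pq q by auto
      then have "p = j" using np by blast
      show False
      proof (cases "q = k")
        case True
        then show False using s s_eq u_eq \<open>p = j\<close> by simp
      next
        case False
        then have "q < k" using q by simp
        moreover have "v q \<noteq> v k" using False permutes_inj[OF v] by (simp add: inj_eq)
        then have "v q < v k" using q by simp
        ultimately show False using cover[of q] pq \<open>p = j\<close> by blast
      qed
    qed
    then show "s \<in> {x. 0 \<le> l \<bullet> x}" by (simp add: s_eq inner_coordinate_weight)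
  qed
  then have "convex_cone hull (cover_roots v w - {u}) \<subseteq> {x. 0 \<le> l \<bullet> x}"
    by (rule hull_minimal) (rule convex_cone_halfspace_ge)
  then have "0 \<le> l \<bullet> u" using mem by blast
  then show False using jk by (auto simp: u_eq inner_coordinate_weight l split: if_splits)
qed

text \<open>
  A functional that is positive on all positive roots, and so witnesses that the weight cone is pointed.
\<close>

definition height_functional :: "'n::{finite,linorder} rvec" where
  "height_functional = (\<chi> x. - real (card {y. y < x}))"

lemma height_functional_pos: "v j < i \<Longrightarrow> 0 < height_functional \<bullet> coordinate_weight v i j"
  using strict_mono_position[of "v j" i] by (simp add: inner_coordinate_weight height_functional_def)

text \<open>
  Every member of an irredundant set of generating roots is exposed among these generators. It is then
  exposed among all roots, because a root on the ray of another root is equal to it.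
\<close>

lemma weight_cone_cover_roots:
  fixes v w :: "'n::{finite,linorder} \<Rightarrow> 'n"
  assumes v: "v permutes UNIV" and w: "w permutes UNIV"
  shows "weight_cone v w = convex_cone hull cover_roots v w"
proof -
  have sub: "cover_roots v w \<subseteq> kl_roots v w"
    using bruhat_le_imp_kl_root[OF v w] unfolding cover_roots_def by blast
  obtain R0 where R0: "R0 \<subseteq> kl_roots v w" "convex_cone hull R0 = convex_cone hull kl_roots v w"
    and irr: "\<And>r. r \<in> R0 \<Longrightarrow> r \<notin> convex_cone hull (R0 - {r})"
    using irredundant_generators[OF finite_kl_roots] by metis
  have pos: "0 < height_functional \<bullet> s" if "s \<in> kl_roots v w" for s
    using kl_roots_cases[OF v that] height_functional_pos by metis
  have "R0 \<subseteq> cover_roots v w"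
  proof
    fix r assume r: "r \<in> R0"
    have "finite R0" using R0(1) finite_kl_roots finite_subset by blast
    then obtain l where l: "l \<bullet> r = 0" "\<And>s. s \<in> R0 - {r} \<Longrightarrow> 0 < l \<bullet> s"
      using exposing_functional[OF _ r irr[OF r], of height_functional] pos R0(1) by blast
    have rR: "r \<in> kl_roots v w" using r R0 by blast
    have "0 < l \<bullet> s" if s: "s \<in> kl_roots v w - {r}" for s
    proof -
      have "s \<in> convex_cone hull R0" using s R0(2) by (simp add: hull_inc)
      then consider "0 < l \<bullet> s" | "s \<in> conic hull {r}"
        using convex_cone_hull_exposed_ray[OF l] by blast
      then show ?thesis
      proof cases
        case 2
        then obtain c where c: "s = c *\<^sub>R r" by (auto simp: conic_hull_explicit)
        obtain j k where jk: "v j < v k" "r = coordinate_weight v (v k) j"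
          using kl_roots_cases[OF v rR] by metis
        obtain p q where pq: "v p < v q" "s = coordinate_weight v (v q) p"
          using kl_roots_cases[OF v, of s w] s by (metis DiffD1)
        have entry: "axis (v p) 1 $ x - axis (v q) 1 $ x = c * (axis (v j) 1 $ x - axis (v k) 1 $ x)" for x
          using c by (simp add: jk pq coordinate_weight_def vec_eq_iff)
        have "c = 1 \<and> v p = v j \<and> v q = v k"
          using entry[of "v p"] entry[of "v q"] entry[of "v j"] jk(1) pq(1) by (auto simp: axis_def split: if_splits)
        then show ?thesis using s c by simp
      qed
    qed
    then show "r \<in> cover_roots v w"
      using exposed_kl_root_is_cover_root[OF v w rR l(1)] by blast
  qed
  then have "convex_cone hull kl_roots v w \<subseteq> convex_cone hull cover_roots v w"
    unfolding R0(2)[symmetric] by (rule hull_mono)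
  moreover have "convex_cone hull cover_roots v w \<subseteq> convex_cone hull kl_roots v w"
    by (rule hull_mono[OF sub])
  ultimately show ?thesis by (simp add: weight_cone_eq[OF v w])
qed

lemma extremal_rays_weight_cone:
  fixes v w :: "'n::{finite,linorder} \<Rightarrow> 'n"
  assumes v: "v permutes UNIV" and w: "w permutes UNIV"
  shows "extremal_rays (weight_cone v w) = (\<lambda>u. conic hull {u}) ` cover_roots v w"
  unfolding weight_cone_cover_roots[OF assms]
proof (rule extremal_rays_irredundant)
  have "cover_roots v w \<subseteq> (\<lambda>(j, k). coordinate_weight v (v k) j) ` UNIV" by (auto simp: cover_roots_def)
  then show "finite (cover_roots v w)" by (rule finite_subset) simp
  show "0 < height_functional \<bullet> u" if "u \<in> cover_roots v w" for u
    using that height_functional_pos by (auto simp: cover_roots_def)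
qed (rule cover_root_irredundant[OF v])

text \<open>
  Each root has an entry \<open>1\<close>, hence is the primitive lattice vector on its ray.
\<close>

lemma extremal_ray_generators_roots:
  fixes v w :: "'n::{finite,linorder} \<Rightarrow> 'n"
  assumes rays: "extremal_rays C = (\<lambda>u. conic hull {u}) ` W"
    and W: "\<And>u. u \<in> W \<Longrightarrow> \<exists>i j. u = coordinate_weight v i j \<and> i \<noteq> v j"
  shows "extremal_ray_generators C = W"
proof
  show "extremal_ray_generators C \<subseteq> W"
  proof
    fix x assume "x \<in> extremal_ray_generators C"
    then obtain m where x: "x = char_vec m" and gcd: "Gcd (range m) = 1"
      and "conic hull {char_vec m} \<in> (\<lambda>u. conic hull {u}) ` W"
      unfolding extremal_ray_generators_def rays by blast
    then obtain u where u: "u \<in> W" and eq: "conic hull {char_vec m} = conic hull {u}" by blast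
    obtain i j where ij: "u = coordinate_weight v i j" "i \<noteq> v j" using W[OF u] by blast
    have "char_vec m \<in> conic hull {u}" unfolding eq[symmetric] by (simp add: hull_inc)
    then obtain c where c: "char_vec m = c *\<^sub>R u" "0 \<le> c" by (auto simp: conic_hull_explicit)
    have entry: "of_int (m x) = c * ((if x = v j then 1 else 0) - (if x = i then 1 else 0))" for x
      using arg_cong[OF c(1), of "\<lambda>y. y $ x"] by (simp add: char_vec_def ij coordinate_weight_def axis_def)
    have c_eq: "c = of_int (m (v j))" using entry[of "v j"] ij by simp
    have "real_of_int (m x) = of_int (m (v j) * (of_bool (x = v j) - of_bool (x = i)))" for x
      using entry[of x] by (auto simp: c_eq)
    (* char_vec m is the multiple of u by the integer m (v j), which is a common divisor *)
    then have "m (v j) dvd m x" for x by (metis of_int_eq_iff dvd_triv_left)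
    then have "m (v j) dvd Gcd (range m)" by (auto intro: Gcd_greatest)
    then have "m (v j) = 1" using gcd c(2) c_eq by (auto simp: zdvd1_eq)
    then show "x \<in> W" using c c_eq x u by simp
  qed
  show "W \<subseteq> extremal_ray_generators C"
  proof
    fix u assume u: "u \<in> W"
    obtain i j where ij: "u = coordinate_weight v i j" "i \<noteq> v j" using W[OF u] by blast
    let ?m = "\<lambda>k. of_bool (k = v j) - of_bool (k = i) :: int"
    have "1 \<in> range ?m" using ij(2) by (intro image_eqI[of _ _ "v j"]) auto
    then have "Gcd (range ?m) = 1" using Gcd_dvd[of 1 "range ?m"] by simp
    moreover have "u = char_vec ?m" by (simp only: ij(1) char_vec_root)
    ultimately show "u \<in> extremal_ray_generators C"
      unfolding extremal_ray_generators_def rays using u by blast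
  qed
qed

theorem theorem4p11:
  fixes v w :: "'n::{finite,linorder} \<Rightarrow> 'n"
  assumes "v permutes UNIV" and "w permutes UNIV"
    and "bruhat_le v w"
  shows "let W = {coordinate_weight v i j |i j. (i, j) \<in> opp_rothe_diagram v \<and>
           bruhat_le (Transposition.transpose (v j) i \<circ> v) w \<and>
           int (coxeter_length (Transposition.transpose (v j) i \<circ> v)) - int (coxeter_length v) = 1}
         in extremal_ray_generators (weight_cone v w) = W \<and>
            extremal_rays (weight_cone v w) = (\<lambda>u. conic hull {u}) ` W"
proof -
  note v = assms(1) and w = assms(2)
  have cover: "int (coxeter_length (swap_values v j k)) - int (coxeter_length v) = 1
      \<longleftrightarrow> (\<forall>p. j < p \<longrightarrow> p < k \<longrightarrow> \<not> (v j < v p \<and> v p < v k))" if "j < k" "v j < v k" for j k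
    using coxeter_length_swap_values[OF v that] by (auto simp: card_eq_0_iff)
  let ?W = "{coordinate_weight v i j |i j. (i, j) \<in> opp_rothe_diagram v \<and>
           bruhat_le (Transposition.transpose (v j) i \<circ> v) w \<and>
           int (coxeter_length (Transposition.transpose (v j) i \<circ> v)) - int (coxeter_length v) = 1}"
  have "?W = cover_roots v w"
  proof
    show "?W \<subseteq> cover_roots v w"
    proof
      fix u assume "u \<in> ?W"
      then obtain i j where ij: "u = coordinate_weight v i j" "v j < i" "j < inv v i"
        "bruhat_le (Transposition.transpose (v j) i \<circ> v) w"
        "int (coxeter_length (Transposition.transpose (v j) i \<circ> v)) - int (coxeter_length v) = 1"
        unfolding opp_rothe_diagram_def by blast
      define k where "k = inv v i"
      have "i = v k" by (simp add: k_def permutes_inverses[OF v])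
      then show "u \<in> cover_roots v w"
        using ij cover[of j k] unfolding cover_roots_def swap_values_def k_def[symmetric] by blast
    qed
    show "cover_roots v w \<subseteq> ?W"
    proof
      fix u assume "u \<in> cover_roots v w"
      then obtain j k where jk: "u = coordinate_weight v (v k) j" "j < k" "v j < v k"
        "bruhat_le (swap_values v j k) w"
        "\<forall>p. j < p \<longrightarrow> p < k \<longrightarrow> \<not> (v j < v p \<and> v p < v k)"
        unfolding cover_roots_def by blast
      then have "(v k, j) \<in> opp_rothe_diagram v"
        by (simp add: opp_rothe_diagram_def permutes_inverses[OF v])
      then show "u \<in> ?W"
        using jk cover[of j k] unfolding swap_values_def by blast
    qed
  qed
  moreover have "extremal_ray_generators (weight_cone v w) = cover_roots v w"
    by (rule extremal_ray_generators_roots[OF extremal_rays_weight_cone[OF v w]])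
       (force simp: cover_roots_def)
  ultimately show ?thesis
    by (simp add: Let_def extremal_rays_weight_cone[OF v w])
qed

end
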